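(* Let $k\ge 2$ and $n\ge 0$ be integers and write $N=(2k+1)n+r$ with $0\le r\le 2k$. Then for $c$ an indeterminate, \[ \det_{0\leq i,j \leq N-1}\big(\mathrm{Cat}_{i+j+2,k}^{(1,c)}\big) = \begin{cases} \left(\frac{F_{(2k+1)n}(c)}{F_{2k+1}(c)} + \frac{F_{(2k+1)(n+1)}(c)}{F_{2k+1}(c)}\right)^2, & \text{if } r=0,\\[6pt] (-1)^{\binom{k-1}{2}}\left(\frac{F_{(2k+1)n}(c)}{F_{2k+1}(c)} + \frac{F_{(2k+1)(n+1)}(c)}{F_{2k+1}(c)}\right)^2, & \text{if } r=k-1,\\[6pt] (-1)^{\binom{k+1}{2}}\big(L_{k+1}(c)+L_{k}(c)\big)^2\left(\frac{F_{(2k+1)(n+1)}(c)}{F_{2k+1}(c)}\right)^2, & \text{if } r=k+1,\\[6pt] -\big(L_{k+1}(c)+L_{k}(c)\big)^2\left(\frac{F_{(2k+1)(n+1)}(c)}{F_{2k+1}(c)}\right)^2, & \text{if } r=2k-1,\\[6pt] 0, & \text{if } r\notin\{0,\,k-1,\,k,\,k+1,\,2k-1,\,2k\}, \end{cases} \] and \[ \begin{aligned} &\det_{0\leq i,j \leq (2k+1)n+2k-1}\big(\mathrm{Cat}_{i+j+2,k}^{(1,c)}\big) + (-1)^{\binom{k-1}{2}}\det_{0\leq i,j \leq (2k+1)n+k-1}\big(\mathrm{Cat}_{i+j+2,k}^{(1,c)}\big)\\ &\qquad = (-1)^k \big(L_{k+1}(c)+L_{k}(c)\big)^2 \big(F'_{k+1}(c)-F'_k(c)\big)\left(\frac{F_{(2k+1)(n+1)}(c)}{F_{2k+1}(c)}\right)^2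 . \end{aligned} \] In addition, the $r=0$ case of the first formula and the second relation hold when $k=1$; namely, for all integers $n\ge 0$, \[ \det_{0\leq i,j \leq 3n-1}\big(\mathrm{Cat}_{i+j+2,1}^{(1,c)}\big) = \left(\frac{F_{3n}(c)}{c^2-1} + \frac{F_{3n+3}(c)}{c^2-1}\right)^2 \] and \[ \det_{0\leq i,j \leq 3n+1}\big(\mathrm{Cat}_{i+j+2,1}^{(1,c)}\big) + \det_{0\leq i,j \leq 3n}\big(\mathrm{Cat}_{i+j+2,1}^{(1,c)}\big) = -\left(\frac{c+2}{c+1} F_{3n+3}(c)\right)^2 . \]
   Context: For a sequence $(s_k)_{k\ge 0}$, let $\mathrm{Cat}_{n,k}^{(s)}$ be the array defined for $n\ge 1$, $k\ge 0$ by $\mathrm{Cat}_{n,k}^{(s)}=\mathrm{Cat}_{n-1,k-1}^{(s)}+s_k \mathrm{Cat}_{n-1,k}^{(s)}+\mathrm{Cat}_{n-1,k+1}^{(s)}$, with boundary values $\mathrm{Cat}_{0,0}^{(s)}=1$, $\mathrm{Cat}_{0,k}^{(s)}=0$ for $k\ge 1$, and $\mathrm{Cat}_{n,k}^{(s)}=0$ for $k<0$. For $b\in\{0,1\}$ write $\mathrm{Cat}_{n,k}^{(b,c)}$ for $\mathrm{Cat}_{n,k}^{(s)}$ with $s=(b+c,c,c,c,\ldots)$, i.e. $s_0=b+c$ and $s_k=c$ for $k\ge 1$. The polynomials $F_n(x)$ and $L_n(x)$ are defined by $F_0(x)=0$, $F_1(x)=1$, $F_n(x)=xF_{n-1}(x)-F_{n-2}(x)$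 and $L_0(x)=2$, $L_1(x)=x$, $L_n(x)=xL_{n-1}(x)-L_{n-2}(x)$ for $n\ge 2$. Here $F_n'(c)$ denotes the derivative $\frac{d}{dx}F_n(x)$ evaluated at $x=c$. The notation $\det_{0\le i,j\le N-1}(a_{i,j})$ is the determinant of the $N\times N$ matrix $(a_{i,j})$; the empty determinant ($N=0$) is $1$. *)

theory Defs
  imports
    "HOL-Computational_Algebra.Polynomial"
    "HOL-Computational_Algebra.Fraction_Field"
    "Jordan_Normal_Form.Determinant"
begin

(* The second argument is a natural number, so the boundary value 0 for negative
   indices is built into the recursion. *)
fun Cat :: "(nat \<Rightarrow> 'a :: comm_ring_1) \<Rightarrow> nat \<Rightarrow> nat \<Rightarrow> 'a" where
  "Cat s 0 k = (if k = 0 then 1 else 0)"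
| "Cat s (Suc n) k = (if k = 0 then 0 else Cat s n (k - 1)) + s k * Cat s n k + Cat s n (k + 1)"

definition Cat_bc :: "'a :: comm_ring_1 \<Rightarrow> 'a \<Rightarrow> nat \<Rightarrow> nat \<Rightarrow> 'a" where
  "Cat_bc b c n k = Cat (\<lambda>j. if j = 0 then b + c else c) n k"

fun F :: "nat \<Rightarrow> 'a :: comm_ring_1 poly" where
  "F 0 = 0"
| "F (Suc 0) = 1"
| "F (Suc (Suc n)) = [:0, 1:] * F (Suc n) - F n"

fun L :: "nat \<Rightarrow> 'a :: comm_ring_1 poly" where
  "L 0 = 2"
| "L (Suc 0) = [:0, 1:]"
| "L (Suc (Suc n)) = [:0, 1:] * L (Suc n) - L n"

(* The field of rational functions over the rationals, as the fraction field of the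
   integer polynomials; indet is the indeterminate. *)
type_synonym ratfun = "int poly fract"

definition indet :: ratfun where
  "indet = Fract [:0, 1:] 1"

(* det over 0 <= i, j <= N - 1 of Cat_{i+j+2,k}^{(1,c)}; equal to 1 for N = 0. *)
definition H :: "'a :: comm_ring_1 \<Rightarrow> nat \<Rightarrow> nat \<Rightarrow> 'a" where
  "H c k N = det (mat N N (\<lambda>(i, j). Cat_bc 1 c (i + j + 2) k))"

end

theory Submission
  imports Defs
begin

text \<open>Put \<open>y = 2 cos t\<close> and let \<open>M = 2 * k + 1\<close>. The polynomials \<open>V n = cos ((n + 1/2) t) / cos (t/2)\<close> and
\<open>W n = sin ((n + 1/2) t) / sin (t/2)\<close> are the rescaled Chebyshev polynomials of the third and fourth
kind. Multiplication by \<open>y + c\<close> acts on the basis \<open>V 0, V 1, \<dots>\<close> by the tridiagonal matrix that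
generates the array, so \<open>Cat_bc 1 c n k\<close> is the value of the functional \<open>moment\<close>, for which the \<open>V n\<close> are
orthonormal, at \<open>(y + c)^n V k\<close>. Therefore \<open>H c k N\<close> is the Hankel determinant of that functional
twisted by the polynomial weight \<open>Q = (y + c)^2 V k\<close> of degree \<open>k + 2\<close>. A form of Christoffel's
formula (\<open>det_Christoffel\<close>) turns it, up to sign, into the determinant of size \<open>k + 2\<close> formed by the
remainders of \<open>V N, \<dots>, V (N + k + 1)\<close> modulo \<open>Q\<close>; no root of \<open>Q\<close> has to be named.

Modulo \<open>V k\<close> alone, \<open>V (p + M) = - V p\<close> and \<open>V (2 * k - m) = - V m\<close>, so every remainder is \<open>0\<close> or, up to
sign, one of \<open>V 0, \<dots>, V (k - 1)\<close>. If a window of \<open>k + 2\<close> consecutive indices misses one of the pairs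
\<open>{m, 2 * k - m}\<close> with \<open>m < k\<close> modulo \<open>M\<close>, the determinant has a zero column (\<open>H_residue_other\<close>). The windows that meet
all pairs are those starting at the residues \<open>0, k - 1, k, k + 1, 2 * k - 1, 2 * k\<close>. For them, row
operations and reversals of rows leave \<open>k\<close> multiples of unit vectors and a two-by-two block
\<open>f g' - f' g\<close>, where \<open>f\<close> and \<open>g\<close> are quotients by \<open>V k\<close> of combinations of the \<open>V p\<close>, evaluated at
\<open>y = -c\<close>. The quotients that occur come from

  \<open>A n = V (M * n + k) / V k\<close> and \<open>B n = (V (M * (n + 1)) - V (M * (n + 1) - 1)) / V k\<close>.

At the residues \<open>0\<close> and \<open>k - 1\<close> the block belongs to \<open>A n\<close> and \<open>y A n\<close>, at \<open>k + 1\<close> and \<open>2 * k - 1\<close> to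
\<open>B n\<close> and \<open>(y + 1) B n\<close>. Since the Wronskian of \<open>f\<close> and \<open>(y + a) f\<close> is \<open>f^2\<close>, these determinants are
squares up to sign. At \<open>k\<close> and \<open>2 * k\<close> the block is a Wronskian of \<open>B n\<close> with \<open>A n\<close> and with \<open>A (n + 1)\<close>;
as \<open>A (n + 1) - A n = W k * B n\<close>, the combination in the theorem is minus the Wronskian of
\<open>B n\<close> and \<open>W k * B n\<close>, that is \<open>- (W k)' * (B n)^2\<close>. The values at \<open>-c\<close> follow from sum-to-product identities
such as \<open>F p + F (p + M) = V k * W (p + k)\<close> and \<open>(y + 2) V k = L (k + 1) + L k\<close>.\<close>

section \<open>Chebyshev polynomials of the third and fourth kind\<close>

text \<open>A constant for the polynomial variable keeps products with it in the form \<open>yvar * p\<close>; the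
simplifier would turn products with the literal list of coefficients into shifted lists.\<close>

definition yvar :: "'a::comm_ring_1 poly" where "yvar = [:0, 1:]"

definition V :: "nat \<Rightarrow> 'a::comm_ring_1 poly" where "V n = F (Suc n) - F n"
definition W :: "nat \<Rightarrow> 'a::comm_ring_1 poly" where "W n = F (Suc n) + F n"

lemma F_rec: "F (Suc (Suc n)) = yvar * F (Suc n) - F n"
  by (simp add: yvar_def)

lemma L_rec: "L (Suc (Suc n)) = yvar * L (Suc n) - L n"
  by (simp add: yvar_def)

lemma L_1: "L (Suc 0) = yvar"
  by (simp add: yvar_def)

declare F.simps(3) [simp del] L.simps(2,3) [simp del]

lemma V_0: "V 0 = 1" by (simp add: V_def)
lemma V_1: "V (Suc 0) = yvar - 1" by (simp add: V_def F_rec)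
lemma V_rec: "V (Suc (Suc n)) = yvar * V (Suc n) - V n"
  by (simp add: V_def F_rec algebra_simps)

lemma W_0: "W 0 = 1" by (simp add: W_def)
lemma W_1: "W (Suc 0) = yvar + 1" by (simp add: W_def F_rec)
lemma W_rec: "W (Suc (Suc n)) = yvar * W (Suc n) - W n"
  by (simp add: W_def F_rec algebra_simps)

lemma two_step_induct [case_names 0 1 step]:
  fixes P :: "nat \<Rightarrow> bool"
  assumes "P 0" and "P (Suc 0)" and "\<And>n. P n \<Longrightarrow> P (Suc n) \<Longrightarrow> P (Suc (Suc n))"
  shows "P n"
proof -
  have "P n \<and> P (Suc n)" by (induction n) (use assms in auto)
  thus ?thesis ..
qed

lemma V_degree: "degree (V n :: 'a::field poly) = n \<and> coeff (V n :: 'a poly) n = 1"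
proof (induction n rule: two_step_induct)
  case 0 thus ?case by (simp add: V_0)
next
  case 1 show ?case by (simp add: V_1 yvar_def one_pCons)
next
  case (step n)
  have nz: "V (Suc n) \<noteq> (0 :: 'a poly)" using step by auto
  have d: "degree (yvar * V (Suc n) :: 'a poly) = Suc (Suc n)"
    using step nz by (simp add: yvar_def)
  have l: "coeff (yvar * V (Suc n) :: 'a poly) (Suc (Suc n)) = 1"
    using step by (simp add: yvar_def)
  have c0: "coeff (V n :: 'a poly) (Suc (Suc n)) = 0"
    using step by (intro coeff_eq_0) simp
  have "degree (V (Suc (Suc n)) :: 'a poly) \<le> Suc (Suc n)"
    unfolding V_rec using step d by (intro degree_diff_le) auto
  moreover have c1: "coeff (V (Suc (Suc n)) :: 'a poly) (Suc (Suc n)) = 1"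
    unfolding V_rec coeff_diff l c0 by simp
  ultimately have "degree (V (Suc (Suc n)) :: 'a poly) = Suc (Suc n)"
    by (metis le_degree le_antisym zero_neq_one)
  with c1 show ?case by simp
qed

text \<open>The product formula \<open>2 cos (b t) cos ((a + 1/2) t) = cos ((a + b + 1/2) t) + cos ((a - b + 1/2) t)\<close>.
For \<open>a = k\<close> it gives the reflection \<open>V (2 * k - m) = - V m\<close> modulo \<open>V k\<close>.\<close>

lemma V_add_sub:
  assumes "b \<le> a"
  shows "V (a + b) + V (a - b) = L b * V a"
  using assms
proof (induction b rule: two_step_induct)
  case 0 thus ?case by simp
next
  case 1
  then obtain a' where "a = Suc a'" by (cases a) auto
  thus ?case by (simp add: V_rec L_1)
next
  case (step b)
  then obtain e where e: "a = Suc (Suc (b + e))"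
    by (metis add_Suc le_Suc_ex)
  have s: "a + Suc (Suc b) = Suc (Suc (a + b))" "a - Suc (Suc b) = e"
    "a + Suc b = Suc (a + b)" "a - Suc b = Suc e" "a - b = Suc (Suc e)"
    using e by auto
  have 1: "V (a + b) + V (Suc (Suc e)) = L b * (V a :: 'a poly)" using step(1) step.prems s by simp
  have 2: "V (Suc (a + b)) + V (Suc e) = L (Suc b) * (V a :: 'a poly)" using step(2) step.prems s by simp
  have "L (Suc (Suc b)) * (V a :: 'a poly) = yvar * (L (Suc b) * V a) - L b * V a"
    by (simp add: L_rec algebra_simps)
  also have "\<dots> = V (Suc (Suc (a + b))) + V e"
    unfolding 1[symmetric] 2[symmetric] V_rec by (simp add: algebra_simps)
  finally show ?case using s by simp
qed

text \<open>The same product formula in the range where \<open>a - b\<close> is negative and \<open>V (-p - 1) = V p\<close> has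
to be used. It shows that \<open>V\<close> changes sign under a shift by \<open>2 * k + 1\<close> modulo \<open>V k\<close>. Both sides satisfy
the same three-term recurrence in \<open>p\<close>, which leaves the cases \<open>p = 0\<close> and \<open>p = 1\<close>.\<close>

lemma V_shift: "V (p + 2 * k + 1) + V p = L (p + k + 1) * V k"
proof (cases k)
  case 0
  show ?thesis
  proof (induction p rule: two_step_induct)
    case (step n)
    hence 1: "V (Suc n) + V n = (L (Suc n) :: 'a poly)"
      and 2: "V (Suc (Suc n)) + V (Suc n) = (L (Suc (Suc n)) :: 'a poly)"
      using 0 by (simp_all add: V_0)
    have "L (Suc (Suc (Suc n))) = V (Suc (Suc (Suc n))) + (V (Suc (Suc n)) :: 'a poly)"
      unfolding L_rec[of "Suc n"] 1[symmetric] 2[symmetric] V_rec[of "Suc n"] V_rec[of n]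
      by (simp add: algebra_simps)
    thus ?case using 0 by (simp add: V_0 add.commute)
  qed (simp_all add: 0 V_0 V_1 L_1 V_rec L_rec algebra_simps)
next
  case (Suc j)
  have a0: "V (2 * k) + 1 = L k * (V k :: 'a poly)" using V_add_sub[of k k] by (simp add: V_0 mult_2)
  have a1: "V (Suc (2 * j)) + V (Suc 0) = L j * (V k :: 'a poly)"
    using V_add_sub[of j k] Suc by (simp add: mult_2)
  have k2: "2 * k = Suc (Suc (2 * j))" using Suc by simp
  have b0: "V (Suc (2 * k)) + 1 = L (Suc k) * (V k :: 'a poly)"
  proof -
    have "L (Suc k) * (V k :: 'a poly) = yvar * (L k * V k) - L j * V k"
      using Suc by (simp add: L_rec algebra_simps)
    also have "\<dots> = V (Suc (2 * k)) + 1"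
      unfolding a0[symmetric] a1[symmetric] k2 V_rec[of "Suc (2 * j)"] V_1
      by (simp add: algebra_simps)
    finally show ?thesis by simp
  qed
  have b1: "V (Suc (Suc (2 * k))) + V (Suc 0) = L (Suc (Suc k)) * (V k :: 'a poly)"
  proof -
    have "L (Suc (Suc k)) * (V k :: 'a poly) = yvar * (L (Suc k) * V k) - L k * V k"
      by (simp add: L_rec algebra_simps)
    also have "\<dots> = V (Suc (Suc (2 * k))) + V (Suc 0)"
      unfolding a0[symmetric] b0[symmetric] V_rec[of "2 * k"] V_1
      by (simp add: algebra_simps)
    finally show ?thesis by simp
  qed
  show ?thesis
  proof (induction p rule: two_step_induct)
    case 0 show ?case using b0 by (simp add: V_0)
  next
    case 1 show ?case using b1 by (simp add: V_0)
  next
    case (step p)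
    let ?q = "p + 2 * k"
    have 1: "V (Suc ?q) + V p = L (Suc (p + k)) * (V k :: 'a poly)" using step(1) by simp
    have 2: "V (Suc (Suc ?q)) + V (Suc p) = L (Suc (Suc (p + k))) * (V k :: 'a poly)" using step(2) by simp
    have "L (Suc (Suc (Suc (p + k)))) * (V k :: 'a poly)
        = yvar * (L (Suc (Suc (p + k))) * V k) - L (Suc (p + k)) * V k"
      unfolding L_rec[of "Suc (p + k)"] by (simp add: algebra_simps)
    also have "\<dots> = V (Suc (Suc (Suc ?q))) + V (Suc (Suc p))"
      unfolding 1[symmetric] 2[symmetric] V_rec[of "Suc ?q"] V_rec[of p]
      by (simp add: algebra_simps)
    finally show ?case by simp
  qed
qed

text \<open>Differences symmetric about the gap between \<open>m\<close> and \<open>m + 1\<close> are multiples of the innermost one: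
in terms of \<open>t\<close> the left side is \<open>-2 sin ((m + 1) t) sin ((k + 1/2) t) / cos (t/2)\<close>.\<close>

lemma V_diff_around:
  "k \<le> m \<Longrightarrow> V (Suc m + k) - V (m - k) = W k * (V (Suc m) - V m)"
proof (induction k rule: two_step_induct)
  case 0 thus ?case by (simp add: W_0)
next
  case 1
  then obtain a where "m = Suc a" by (cases m) auto
  thus ?case by (simp add: V_rec W_1 algebra_simps)
next
  case (step k)
  then obtain e where e: "m = Suc (Suc (k + e))"
    by (metis add_Suc le_Suc_ex)
  have s: "m - k = Suc (Suc e)" "m - Suc k = Suc e" "m - Suc (Suc k) = e" using e by auto
  have 1: "V (Suc (m + k)) - V (Suc (Suc e)) = W k * (V (Suc m) - V m :: 'a poly)"
    using step(1) step.prems s by simp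
  have 2: "V (Suc (Suc (m + k))) - V (Suc e) = W (Suc k) * (V (Suc m) - V m :: 'a poly)"
    using step(2) step.prems s by simp
  have "W (Suc (Suc k)) * (V (Suc m) - V m :: 'a poly)
      = yvar * (W (Suc k) * (V (Suc m) - V m)) - W k * (V (Suc m) - V m)"
    by (simp add: W_rec algebra_simps)
  also have "\<dots> = V (Suc (Suc (Suc (m + k)))) - V e"
    unfolding 1[symmetric] 2[symmetric] V_rec[of "Suc (m + k)"] V_rec[of e]
    by (simp add: algebra_simps)
  finally show ?case using s by simp
qed

lemma V_consecutive: "V (Suc m) - V m = (yvar - 2) * F (Suc m)"
  by (simp add: V_def F_rec algebra_simps)

lemma V_mult_L: "(yvar + 2) * V k = L (Suc k) + L k"
proof (induction k rule: two_step_induct)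
  case (step k)
  have "(yvar + 2) * (V (Suc (Suc k)) :: 'a poly) = yvar * ((yvar + 2) * V (Suc k)) - (yvar + 2) * V k"
    by (simp add: V_rec algebra_simps)
  thus ?case unfolding step by (simp add: L_rec[of "Suc k"] L_rec[of k] algebra_simps)
qed (simp_all add: V_0 V_1 L_1 L_rec algebra_simps)

lemma F_add: "F (Suc (a + b)) = F (Suc a) * F (Suc b) - F a * F b"
proof (induction b rule: two_step_induct)
  case (step b)
  have "(F (Suc (a + Suc (Suc b))) :: 'a poly) = yvar * F (Suc (a + Suc b)) - F (Suc (a + b))"
    by (simp add: F_rec)
  thus ?case unfolding step by (simp add: F_rec algebra_simps)
qed (simp_all add: F_rec algebra_simps)

lemma F_cassini: "F (Suc k) * F (Suc k) - F k * F (Suc (Suc k)) = 1"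
proof (induction k)
  case (Suc k)
  thus ?case by (simp add: F_rec algebra_simps)
qed simp

text \<open>The sum-to-product formula for \<open>sin (p t) + sin ((p + 2 * k + 1) t)\<close>. By the recurrence in \<open>p\<close> it
reduces to \<open>p = 0\<close> and \<open>p = 1\<close>, which the addition formula and Cassini's identity settle.\<close>

lemma F_period: "F p + F (p + 2 * k + 1) = V k * W (p + k)"
proof (induction p rule: two_step_induct)
  case 0
  have "F (Suc (k + k)) = V k * (W k :: 'a poly)" by (simp add: F_add V_def W_def algebra_simps)
  thus ?case by (simp add: mult_2)
next
  case 1
  have "1 + F (Suc (Suc k + k)) = V k * (W (Suc k) :: 'a poly)"
    unfolding F_cassini[of k, symmetric] F_add V_def W_def by (simp add: algebra_simps)
  thus ?case by (simp add: mult_2)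
next
  case (step p)
  let ?q = "p + 2 * k"
  have 1: "F p + F (Suc ?q) = V k * (W (p + k) :: 'a poly)" using step(1) by simp
  have 2: "F (Suc p) + F (Suc (Suc ?q)) = V k * (W (Suc (p + k)) :: 'a poly)" using step(2) by simp
  have "V k * (W (Suc (Suc (p + k))) :: 'a poly) = yvar * (V k * W (Suc (p + k))) - V k * W (p + k)"
    by (simp add: W_rec algebra_simps)
  also have "\<dots> = F (Suc (Suc p)) + F (Suc (Suc (Suc ?q)))"
    unfolding 1[symmetric] 2[symmetric] F_rec[of "Suc ?q"] F_rec[of p]
    by (simp add: algebra_simps)
  finally show ?case by simp
qed

lemma F_product: "F (2 * k + 1) = V k * W k"
  using F_period[of 0 k] by simp

text \<open>Everything is evaluated at \<open>y = -c\<close>, where the weight has its double root, whereas the theorem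
speaks of values at \<open>c\<close>; the parity of the polynomials translates, and it exchanges the third kind
with the fourth.\<close>

lemma poly_F_minus: "poly (F n) (- x) = (-1) ^ Suc n * poly (F n) x"
proof (induction n rule: two_step_induct)
  case (step n)
  have "poly (F (Suc (Suc n))) z = z * poly (F (Suc n)) z - poly (F n) z" for z :: 'a
    by (simp add: F_rec yvar_def)
  note rec = this
  show ?case unfolding rec step by (simp add: algebra_simps)
qed simp_all

lemma poly_pderiv_F_minus:
  "poly (pderiv (F n)) (- x) = (-1) ^ n * poly (pderiv (F n)) (x :: 'a::idom)"
proof (induction n rule: two_step_induct)
  case (step n)
  have "poly (pderiv (F (Suc (Suc n)))) z
      = poly (F (Suc n)) z + z * poly (pderiv (F (Suc n))) z - poly (pderiv (F n)) z" for z :: 'a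
    by (simp add: F_rec yvar_def pderiv_diff pderiv_pCons)
  note rec = this
  show ?case unfolding rec step poly_F_minus by (simp add: algebra_simps)
qed simp_all

lemma poly_V_minus: "poly (V n) (- x) = (-1) ^ n * poly (W n) x"
  by (simp add: V_def W_def poly_F_minus algebra_simps)

section \<open>Determinants of a functional with polynomial weight\<close>

definition monic_family :: "(nat \<Rightarrow> 'a::comm_ring_1 poly) \<Rightarrow> bool" where
  "monic_family g \<longleftrightarrow> (\<forall>n. coeff (g n) n = 1 \<and> (\<forall>i>n. coeff (g n) i = 0))"

lemma degree_eq_if_coeffs:
  assumes "coeff f n = (1 :: 'a::comm_ring_1)" and "\<forall>i>n. coeff f i = 0"
  shows "degree f = n" and "f \<noteq> 0"
proof -
  show "degree f = n"
    using degree_le[OF assms(2)] le_degree[of f n] assms(1) by force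
  show "f \<noteq> 0" using assms(1) by force
qed

lemma monic_family_expand:
  assumes g: "monic_family g" and f: "\<forall>i\<ge>n. coeff f i = 0"
  shows "\<exists>t. f = (\<Sum>l<n. smult (t l) (g l))"
  using f
proof (induction n arbitrary: f)
  case 0
  hence "f = 0" by (intro poly_eqI) simp
  thus ?case by simp
next
  case (Suc n)
  define f' where "f' = f - smult (coeff f n) (g n)"
  have "\<forall>i\<ge>n. coeff f' i = 0"
  proof (intro allI impI)
    fix i assume "n \<le> i"
    thus "coeff f' i = 0"
      using g Suc.prems unfolding f'_def monic_family_def by (cases "i = n") auto
  qed
  then obtain t where t: "f' = (\<Sum>l<n. smult (t l) (g l))" using Suc.IH by blast
  define u where "u = t(n := coeff f n)"
  have "(\<Sum>l<n. smult (u l) (g l)) = (\<Sum>l<n. smult (t l) (g l))"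
    by (intro sum.cong) (auto simp: u_def)
  hence "f = (\<Sum>l<Suc n. smult (u l) (g l))"
    using t by (simp add: f'_def u_def algebra_simps)
  thus ?case by blast
qed

lemma monic_family_transition:
  assumes g: "monic_family g" and h: "monic_family h"
  obtains T where "\<And>j. T j j = 1" "\<And>l j. j < l \<Longrightarrow> T l j = 0"
    "\<And>j n. j < n \<Longrightarrow> h j = (\<Sum>l<n. smult (T l j) (g l))"
proof -
  have "\<exists>t. h j = (\<Sum>l<Suc j. smult (t l) (g l))" for j
    using h by (intro monic_family_expand[OF g]) (auto simp: monic_family_def)
  then obtain t where t: "\<And>j. h j = (\<Sum>l<Suc j. smult (t j l) (g l))" by metis
  define T where "T l j = (if l \<le> j then t j l else 0)" for l j
  have "t j j = 1" for j
  proof -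
    have "coeff (h j) j = (\<Sum>l<j. t j l * coeff (g l) j) + t j j * coeff (g j) j"
      by (subst t) (simp add: coeff_sum)
    moreover have "(\<Sum>l<j. t j l * coeff (g l) j) = 0"
      using g by (intro sum.neutral) (auto simp: monic_family_def)
    ultimately show ?thesis using g h by (simp add: monic_family_def)
  qed
  hence 1: "T j j = 1" for j by (simp add: T_def)
  have 2: "T l j = 0" if "j < l" for l j using that by (simp add: T_def)
  have 3: "h j = (\<Sum>l<n. smult (T l j) (g l))" if "j < n" for j n
  proof -
    have "(\<Sum>l<n. smult (T l j) (g l)) = (\<Sum>l<Suc j. smult (T l j) (g l))"
      using that by (intro sum.mono_neutral_right) (auto simp: T_def)
    also have "\<dots> = h j" by (subst t, intro sum.cong) (auto simp: T_def)
    finally show ?thesis by simp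
  qed
  show ?thesis using that[OF 1 2 3] .
qed

locale orthonormal =
  fixes Lam :: "'a::field poly \<Rightarrow> 'a" and p :: "nat \<Rightarrow> 'a poly"
  assumes Lam_add: "Lam (f + g) = Lam f + Lam g"
    and Lam_smult: "Lam (smult a f) = a * Lam f"
    and monic: "monic_family p"
    and orth: "\<forall>i\<ge>n. coeff f i = 0 \<Longrightarrow> Lam (p n * f) = 0"
    and norm: "Lam (p n * p n) = 1"
begin

lemma Lam_0: "Lam 0 = 0"
  using Lam_smult[of 0 0] by simp

lemma Lam_sum: "Lam (\<Sum>x\<in>A. f x) = (\<Sum>x\<in>A. Lam (f x))"
  by (induction A rule: infinite_finite_induct) (simp_all add: Lam_0 Lam_add)

lemma Lam_monic:
  assumes "coeff f n = 1" and "\<forall>i>n. coeff f i = 0"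
  shows "Lam (p n * f) = 1"
proof -
  have "\<forall>i\<ge>n. coeff (f - p n) i = 0"
  proof (intro allI impI)
    fix i assume "n \<le> i"
    thus "coeff (f - p n) i = 0"
      using assms monic unfolding monic_family_def by (cases "i = n") auto
  qed
  hence "Lam (p n * (f - p n)) = 0" by (rule orth)
  moreover have "p n * f = p n * p n + p n * (f - p n)" by (simp add: algebra_simps)
  ultimately show ?thesis by (simp add: Lam_add norm)
qed

text \<open>A change between monic families is given by a unitriangular matrix, so it does not affect the
determinant.\<close>

lemma det_gram_change:
  assumes g: "monic_family g" and h: "monic_family h"
  shows "det (mat n n (\<lambda>(i, j). Lam (f i * g j))) = det (mat n n (\<lambda>(i, j). Lam (f i * h j)))"
proof -
  obtain T where T1: "\<And>j. T j j = 1" and T0: "\<And>l j. j < l \<Longrightarrow> T l j = 0"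
    and T: "\<And>j n. j < n \<Longrightarrow> h j = (\<Sum>l<n. smult (T l j) (g l))"
    using monic_family_transition[OF g h] by blast
  let ?T = "mat n n (\<lambda>(l, j). T l j)"
  have "mat n n (\<lambda>(i, j). Lam (f i * h j)) = mat n n (\<lambda>(i, j). Lam (f i * g j)) * ?T"
  proof (rule eq_matI)
    fix i j assume ij: "i < dim_row (mat n n (\<lambda>(i, j). Lam (f i * g j)) * ?T)"
      "j < dim_col (mat n n (\<lambda>(i, j). Lam (f i * g j)) * ?T)"
    hence i: "i < n" and j: "j < n" by auto
    have "Lam (f i * h j) = (\<Sum>l<n. T l j * Lam (f i * g l))"
      unfolding T[OF j] by (simp add: sum_distrib_left Lam_sum Lam_smult)
    thus "mat n n (\<lambda>(i, j). Lam (f i * h j)) $$ (i, j)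
        = (mat n n (\<lambda>(i, j). Lam (f i * g j)) * ?T) $$ (i, j)"
      using i j by (simp add: scalar_prod_def lessThan_atLeast0 mult.commute)
  qed auto
  moreover have "det ?T = 1"
  proof -
    have "det ?T = prod_list (diag_mat ?T)"
      by (rule det_upper_triangular[of _ n]) (auto simp: upper_triangular_def T0)
    also have "\<dots> = 1"
      by (simp add: prod_list_diag_prod T1)
    finally show ?thesis .
  qed
  ultimately show ?thesis
    by (simp add: det_mult[of _ n])
qed

text \<open>The matrix of all values \<open>Lam (E a * p b)\<close> with \<open>a, b < N + d\<close> is unitriangular by orthogonality, so a
minor of it equals, up to sign, the complementary minor of its inverse, whose entries are the
coefficients \<open>C\<close> of the \<open>p b\<close> in the basis \<open>E\<close>. The proof replaces the inverse by one multiplication with a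
matrix \<open>Y\<close> that selects the last \<open>N\<close> of the \<open>E a\<close> in its first rows and expands
\<open>p N, \<dots>, p (N + d - 1)\<close> in the others; the product is block triangular by orthonormality.\<close>

lemma det_complementary_minor:
  assumes E: "monic_family E" and g: "monic_family g"
    and C: "\<And>i. i < d \<Longrightarrow> p (N + i) = (\<Sum>a<N + d. smult (C i a) (E a))"
  shows "det (mat N N (\<lambda>(i, j). Lam (E (d + i) * g j)))
    = (-1) ^ (N * d) * det (mat d d (\<lambda>(i, a). C i a))"
proof -
  define m where "m = N + d"
  define M where "M = mat m m (\<lambda>(a, b). Lam (E a * p b))"
  define Y where "Y = mat m m (\<lambda>(i, a). if i < N then (if a = d + i then 1 else 0) else C (i - N) a)"
  define H where "H = mat N N (\<lambda>(i, b). Lam (E (d + i) * p b))"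
  define H' where "H' = mat N d (\<lambda>(i, b). Lam (E (d + i) * p (N + b)))"
  have cM: "M \<in> carrier_mat m m" and cY: "Y \<in> carrier_mat m m" by (auto simp: M_def Y_def)
  have orthE: "Lam (E a * p b) = 0" if "a < b" for a b
    using E that by (subst mult.commute, intro orth) (auto simp: monic_family_def)
  have normE: "Lam (E a * p a) = 1" for a
    using E by (subst mult.commute, intro Lam_monic) (auto simp: monic_family_def)
  have detM: "det M = 1"
  proof -
    have "det M = prod_list (diag_mat M)"
      by (rule det_lower_triangular[OF _ cM]) (auto simp: M_def orthE)
    also have "\<dots> = 1" by (simp add: prod_list_diag_prod M_def normE)
    finally show ?thesis .
  qed
  have pp: "Lam (p i * p j) = (if i = j then 1 else 0)" for i j
  proof (cases i j rule: linorder_cases)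
    case less
    thus ?thesis using monic by (subst mult.commute) (auto intro!: orth simp: monic_family_def)
  next
    case greater
    thus ?thesis using monic by (auto intro!: orth simp: monic_family_def)
  qed (simp add: norm)
  have "Y * M = four_block_mat H H' (0\<^sub>m d N) (1\<^sub>m d)"
  proof (rule eq_matI)
    fix i j assume "i < dim_row (four_block_mat H H' (0\<^sub>m d N) (1\<^sub>m d))"
      "j < dim_col (four_block_mat H H' (0\<^sub>m d N) (1\<^sub>m d))"
    hence i: "i < m" and j: "j < m" by (auto simp: H_def m_def)
    have e: "(Y * M) $$ (i, j) = (\<Sum>a<m. Y $$ (i, a) * Lam (E a * p j))"
      using i j cM cY by (simp add: scalar_prod_def lessThan_atLeast0 M_def Y_def)
    show "(Y * M) $$ (i, j) = four_block_mat H H' (0\<^sub>m d N) (1\<^sub>m d) $$ (i, j)"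
    proof (cases "i < N")
      case True
      have "(\<Sum>a<m. Y $$ (i, a) * Lam (E a * p j))
          = (\<Sum>a<m. if a = d + i then Lam (E a * p j) else 0)"
        using True i by (intro sum.cong) (auto simp: Y_def)
      also have "\<dots> = Lam (E (d + i) * p j)" using True by (simp add: m_def)
      finally show ?thesis unfolding e using True i j by (auto simp: H_def H'_def m_def)
    next
      case False
      have iN: "i - N < d" "N + (i - N) = i" using False i by (auto simp: m_def)
      have "(\<Sum>a<m. Y $$ (i, a) * Lam (E a * p j)) = (\<Sum>a<m. Lam (smult (C (i - N) a) (E a) * p j))"
        using False i by (intro sum.cong) (auto simp: Y_def Lam_smult)
      also have "\<dots> = Lam (p (N + (i - N)) * p j)"
        unfolding C[OF iN(1)] by (simp add: m_def sum_distrib_right Lam_sum)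
      finally show ?thesis unfolding e using False i j iN by (auto simp: H_def H'_def m_def pp)
    qed
  qed (use cM cY in \<open>auto simp: H_def m_def\<close>)
  hence "det (Y * M) = det H * det (1\<^sub>m d)"
    by (simp only:, subst det_four_block_mat_lower_left_zero[of _ N _ d])
       (auto simp: H_def H'_def)
  hence detH: "det H = det Y" using detM by (simp add: det_mult[OF cY cM])
  have "det Y = (-1) ^ (N * d) *
      det (mat m m (\<lambda>(i, j). Y $$ (if i < d then i + N else i - d, j)))"
    using det_swap_rows[of Y d N] cY by (simp add: m_def add.commute mult.commute)
  also have "mat m m (\<lambda>(i, j). Y $$ (if i < d then i + N else i - d, j))
      = four_block_mat (mat d d (\<lambda>(i, a). C i a)) (mat d N (\<lambda>(i, a). C i (d + a)))
          (0\<^sub>m N d) (1\<^sub>m N)"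
    by (rule eq_matI) (auto simp: Y_def m_def)
  also have "det \<dots> = det (mat d d (\<lambda>(i, a). C i a)) * det (1\<^sub>m N)"
    by (rule det_four_block_mat_lower_left_zero[of _ d _ N]) auto
  finally have "det H = (-1) ^ (N * d) * det (mat d d (\<lambda>(i, a). C i a))"
    using detH by simp
  thus ?thesis using det_gram_change[OF g monic, of N "\<lambda>i. E (d + i)"] by (simp add: H_def)
qed

text \<open>Christoffel's formula for the weight \<open>Q\<close>, in which the values of the orthogonal polynomials at the
roots of \<open>Q\<close> are replaced by their remainders modulo \<open>Q\<close>. It is the preceding lemma for the
family \<open>e 0, \<dots>, e (d - 1), Q * g 0, Q * g 1, \<dots>\<close>.\<close>

lemma det_Christoffel:
  assumes e: "\<And>a. a < d \<Longrightarrow> coeff (e a) a = 1 \<and> (\<forall>i>a. coeff (e a) i = 0)"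
    and Q: "coeff Q d = 1" "\<forall>i>d. coeff Q i = 0"
    and g: "monic_family g"
    and C: "\<And>i. i < d \<Longrightarrow> p (N + i) = (\<Sum>a<d. smult (C i a) (e a)) + Q * s i"
  shows "det (mat N N (\<lambda>(i, j). Lam (Q * g i * g j)))
    = (-1) ^ (N * d) * det (mat d d (\<lambda>(i, a). C i a))"
proof -
  define E where "E a = (if a < d then e a else Q * g (a - d))" for a
  have degQ: "degree Q = d" "Q \<noteq> 0"
    using degree_eq_if_coeffs[OF Q] by auto
  have E: "monic_family E"
    unfolding monic_family_def
  proof (rule allI, rule conjI)
    fix n
    have dg: "degree (g j) = j" "g j \<noteq> 0" for j
      using degree_eq_if_coeffs[of "g j" j] g by (auto simp: monic_family_def)
    have *: "degree (Q * g j) = d + j" for j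
      using dg degQ by (simp add: degree_mult_eq)
    have "coeff (Q * g j) (d + j) = 1" for j
      using coeff_mult_degree_sum[of Q "g j"] g Q by (simp add: dg degQ monic_family_def)
    from this[of "n - d"] show "coeff (E n) n = 1"
      using e by (auto simp: E_def)
    show "\<forall>i>n. coeff (E n) i = 0"
      using e *[of "n - d"] by (auto simp: E_def intro!: coeff_eq_0)
  qed
  have "\<exists>t. s i = (\<Sum>l<N. smult (t l) (g l))" if i: "i < d" for i
  proof (rule monic_family_expand[OF g], intro allI impI)
    fix j assume j: "N \<le> j"
    \<comment> \<open>Otherwise \<open>Q * s i\<close> would have a term of degree at least \<open>N + d\<close>, which nothing can cancel.\<close>
    have "s i = 0 \<or> degree (s i) < N"
    proof (rule ccontr)
      assume *: "\<not> ?thesis"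
      let ?D = "d + degree (s i)"
      have "degree (Q * s i) = ?D" using * degQ by (simp add: degree_mult_eq)
      moreover have "coeff (Q * s i) ?D = 0"
      proof -
        have "Q * s i = p (N + i) - (\<Sum>a<d. smult (C i a) (e a))" using C[OF i] by simp
        moreover have "coeff (p (N + i)) ?D = 0"
          using * monic i by (auto simp: monic_family_def)
        moreover have "coeff (\<Sum>a<d. smult (C i a) (e a)) ?D = 0"
          using e by (auto simp: coeff_sum intro!: sum.neutral)
        ultimately show ?thesis by simp
      qed
      ultimately have "Q * s i = 0" by (metis leading_coeff_0_iff)
      thus False using * degQ by auto
    qed
    thus "coeff (s i) j = 0" using j by (auto intro: coeff_eq_0)
  qed
  then obtain t where t: "\<And>i. i < d \<Longrightarrow> s i = (\<Sum>l<N. smult (t i l) (g l))" by metis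
  define C' where "C' i a = (if a < d then C i a else t i (a - d))" for i a
  have "p (N + i) = (\<Sum>a<N + d. smult (C' i a) (E a))" if i: "i < d" for i
  proof -
    have "(\<Sum>a<d + N. smult (C' i a) (E a))
        = (\<Sum>a<d. smult (C' i a) (E a)) + (\<Sum>l<N. smult (C' i (d + l)) (E (d + l)))"
      by (induction N) (simp_all add: algebra_simps)
    also have "\<dots> = (\<Sum>a<d. smult (C i a) (e a)) + Q * s i"
      unfolding t[OF i] by (simp add: C'_def E_def sum_distrib_left)
    finally show ?thesis using C[OF i] by (simp add: add.commute)
  qed
  from det_complementary_minor[OF E g this]
  have "det (mat N N (\<lambda>(i, j). Lam (E (d + i) * g j)))
    = (-1) ^ (N * d) * det (mat d d (\<lambda>(i, a). C' i a))" by simp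
  moreover have "mat d d (\<lambda>(i, a). C' i a) = mat d d (\<lambda>(i, a). C i a)"
    by (rule eq_matI) (auto simp: C'_def)
  ultimately show ?thesis by (simp add: E_def)
qed

end

section \<open>The moment functional of the array\<close>

text \<open>The functional whose \<open>n\<close>-th moment is the entry for \<open>c = 0\<close>. Shifting the variable by \<open>c\<close> produces the arrays
for all other \<open>c\<close>, so one functional serves for every \<open>c\<close>.\<close>

definition moment :: "'a::comm_ring_1 poly \<Rightarrow> 'a" where
  "moment f = (\<Sum>n\<le>degree f. coeff f n * Cat_bc 1 0 n 0)"

lemma Cat_bc_0: "Cat_bc b c 0 k = (if k = 0 then 1 else 0)"
  by (simp add: Cat_bc_def)

lemma Cat_bc_Suc_0: "Cat_bc b c (Suc n) 0 = (b + c) * Cat_bc b c n 0 + Cat_bc b c n (Suc 0)"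
  by (simp add: Cat_bc_def)

lemma Cat_bc_Suc_Suc:
  "Cat_bc b c (Suc n) (Suc k) = Cat_bc b c n k + c * Cat_bc b c n (Suc k) + Cat_bc b c n (Suc (Suc k))"
  by (simp add: Cat_bc_def)

lemma Cat_bc_triangular: "Cat_bc b c n n = 1 \<and> (\<forall>k>n. Cat_bc b c n k = 0)"
proof (induction n)
  case (Suc n)
  have "Cat_bc b c (Suc n) k = 0" if "k > Suc n" for k
    using Suc that by (cases k) (simp_all add: Cat_bc_Suc_Suc)
  thus ?case using Suc by (simp add: Cat_bc_Suc_Suc)
qed (simp add: Cat_bc_0)

lemma moment_upto:
  assumes "degree f \<le> m"
  shows "moment f = (\<Sum>n\<le>m. coeff f n * Cat_bc 1 0 n 0)"
  unfolding moment_def using assms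
  by (intro sum.mono_neutral_left) (auto simp: coeff_eq_0)

lemma moment_add: "moment (f + g) = moment f + moment g"
proof -
  let ?m = "max (degree f) (degree g)"
  have "degree (f + g) \<le> ?m" by (rule degree_add_le_max)
  thus ?thesis
    by (simp add: moment_upto[of _ ?m] sum.distrib algebra_simps)
qed

lemma moment_smult: "moment (smult a f) = a * moment f"
  unfolding moment_upto[OF degree_smult_le] by (simp add: moment_def sum_distrib_left mult.assoc)

lemma moment_diff: "moment (f - g) = moment f - moment g"
proof -
  have "moment (f + smult (-1) g) = moment f + moment (smult (-1) g)" by (rule moment_add)
  thus ?thesis unfolding moment_smult by simp
qed

lemma moment_yvar_power: "moment (yvar ^ n) = Cat_bc 1 0 n 0"
proof -
  have "yvar ^ n = (monom 1 n :: 'a poly)" by (simp add: yvar_def monom_altdef)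
  thus ?thesis
    by (simp add: moment_upto[of _ n] degree_monom_le if_distrib[of "\<lambda>x. x * _"] cong: if_cong)
qed

lemma moment_yvar_V: "moment (yvar ^ n * V k) = Cat_bc 1 0 n k"
proof (induction k arbitrary: n rule: two_step_induct)
  case 0 thus ?case by (simp add: V_0 moment_yvar_power)
next
  case 1
  have "moment (yvar ^ n * V (Suc 0)) = moment (yvar ^ Suc n) - moment (yvar ^ n :: 'a poly)"
    unfolding moment_diff[symmetric] by (simp add: V_1 algebra_simps)
  thus ?case by (simp add: moment_yvar_power Cat_bc_Suc_0 del: power_Suc)
next
  case (step k)
  have "moment (yvar ^ n * V (Suc (Suc k))) = moment (yvar ^ Suc n * V (Suc k)) - moment (yvar ^ n * V k :: 'a poly)"
    unfolding moment_diff[symmetric] by (simp add: V_rec algebra_simps)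
  thus ?case by (simp add: step Cat_bc_Suc_Suc del: power_Suc)
qed

text \<open>The recurrence of the array is the recurrence of \<open>V\<close> read as the rule for multiplication by \<open>y + c\<close>;
the exceptional entry \<open>1 + c\<close> reflects \<open>V 1 = y - 1\<close>.\<close>

lemma moment_power_V: "moment ([:c, 1:] ^ n * V k) = Cat_bc 1 c n k"
proof (induction n arbitrary: k)
  case 0 thus ?case using moment_yvar_V[of 0 k] by (simp add: Cat_bc_0)
next
  case (Suc n)
  have X: "[:c, 1:] * f = yvar * f + smult c f" for f :: "'a poly"
    by (simp add: yvar_def)
  show ?case
  proof (cases k)
    case 0
    have "[:c, 1:] * V 0 = V (Suc 0) + smult (1 + c) (V 0)"
      unfolding X by (simp add: V_0 V_1 one_pCons)
    hence "[:c, 1:] ^ Suc n * V 0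
        = [:c, 1:] ^ n * V (Suc 0) + smult (1 + c) ([:c, 1:] ^ n * V 0)"
      by (simp only: power_Suc2 mult.assoc distrib_left mult_smult_right)
    thus ?thesis using 0 by (simp only: moment_add moment_smult Suc Cat_bc_Suc_0) simp
  next
    case (Suc j)
    have "[:c, 1:] * V (Suc j) = V j + smult c (V (Suc j)) + V (Suc (Suc j))"
      unfolding X V_rec by simp
    hence "[:c, 1:] ^ Suc n * V (Suc j)
        = [:c, 1:] ^ n * V j + smult c ([:c, 1:] ^ n * V (Suc j)) + [:c, 1:] ^ n * V (Suc (Suc j))"
      by (simp only: power_Suc2 mult.assoc distrib_left mult_smult_right)
    thus ?thesis using Suc by (simp only: moment_add moment_smult Suc.IH Cat_bc_Suc_Suc)
  qed
qed

lemma monic_family_power: "monic_family (\<lambda>n. [:c :: 'a::field, 1:] ^ n)"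
  unfolding monic_family_def
  by (auto simp: coeff_linear_power degree_linear_power intro: coeff_eq_0)

lemma monic_family_V: "monic_family (V :: nat \<Rightarrow> 'a::field poly)"
  unfolding monic_family_def using V_degree by (auto intro: coeff_eq_0)

text \<open>By triangularity of the array, \<open>V k\<close> is orthogonal to \<open>y^n\<close> for \<open>n < k\<close> and has pairing \<open>1\<close> with \<open>y^k\<close>.\<close>

interpretation V: orthonormal "moment :: 'a::field poly \<Rightarrow> 'a" V
proof
  have mono: "monic_family (\<lambda>n. (yvar :: 'a poly) ^ n)"
    using monic_family_power[of 0] by (simp add: yvar_def)
  have sum: "moment (\<Sum>x\<in>A. f x) = (\<Sum>x\<in>A. moment (f x))" for f :: "nat \<Rightarrow> 'a poly" and A
  proof -
    have "moment (0 :: 'a poly) = 0" by (simp add: moment_def)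
    thus ?thesis by (induction A rule: infinite_finite_induct) (simp_all add: moment_add)
  qed
  show orth: "moment (V n * f) = 0" if "\<forall>i\<ge>n. coeff f i = 0" for n and f :: "'a poly"
  proof -
    obtain t where "f = (\<Sum>l<n. smult (t l) (yvar ^ l))"
      using monic_family_expand[OF mono \<open>\<forall>i\<ge>n. coeff f i = 0\<close>] by blast
    thus ?thesis
      using Cat_bc_triangular[of 1 "0::'a"]
      by (simp add: sum_distrib_left sum moment_smult moment_yvar_V mult.commute[of "V n"])
  qed
  show "moment (V n * V n) = (1 :: 'a)" for n
  proof -
    have "\<forall>i\<ge>n. coeff (V n - yvar ^ n :: 'a poly) i = 0"
    proof (intro allI impI)
      fix i assume "n \<le> i"
      thus "coeff (V n - yvar ^ n :: 'a poly) i = 0"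
        using mono monic_family_V[where 'a = 'a] unfolding monic_family_def
        by (cases "i = n") auto
    qed
    hence "moment (V n * (V n - yvar ^ n)) = (0 :: 'a)" by (rule orth)
    hence "moment (V n * V n) = moment (yvar ^ n * V n :: 'a poly)"
      by (simp add: right_diff_distrib moment_diff mult.commute)
    thus ?thesis using Cat_bc_triangular[of 1 "0::'a" n] by (simp add: moment_yvar_V)
  qed
qed (simp_all add: moment_add moment_smult monic_family_V)

section \<open>Row operations on determinants\<close>

text \<open>The matrix is given by its rows as functions, so that row operations become function updates and
compositions.\<close>

definition rows_det :: "nat \<Rightarrow> (nat \<Rightarrow> nat \<Rightarrow> 'a) \<Rightarrow> 'a::comm_ring_1" where
  "rows_det d f = det (mat d d (\<lambda>(i, j). f i j))"

lemma rows_det_add_row: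
  assumes "i0 < d" "j0 < d" "i0 \<noteq> j0"
  shows "rows_det d (f(i0 := \<lambda>a. f i0 a + s * f j0 a)) = rows_det d f"
proof -
  have "mat d d (\<lambda>(i, j). (f(i0 := \<lambda>a. f i0 a + s * f j0 a)) i j)
      = addrow s i0 j0 (mat d d (\<lambda>(i, j). f i j))"
    using assms by (intro eq_matI) auto
  thus ?thesis unfolding rows_det_def using assms by (simp only:) (rule det_addrow, auto)
qed

text \<open>Reversing \<open>m + 1\<close> rows amounts to reversing the first \<open>m\<close> and then moving the last one to the front, which
costs \<open>m\<close> transpositions.\<close>

lemma rows_det_reverse:
  "m \<le> d \<Longrightarrow> rows_det d f = (-1) ^ (m choose 2) * rows_det d (\<lambda>i. f (if i < m then m - 1 - i else i))"
proof (induction m)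
  case (Suc m)
  let ?g = "\<lambda>i. f (if i < m then m - 1 - i else i)"
  have "rows_det d ?g = (-1) ^ (m * 1) * det (mat d d (\<lambda>(i, j). mat d d (\<lambda>(i, j). ?g i j) $$
      (if i < 1 then i + m else if i < m + 1 then i - 1 else i, j)))"
    unfolding rows_det_def using Suc.prems by (intro det_swap_initial_rows) auto
  also have "mat d d (\<lambda>(i, j). mat d d (\<lambda>(i, j). ?g i j) $$
      (if i < 1 then i + m else if i < m + 1 then i - 1 else i, j))
      = mat d d (\<lambda>(i, j). f (if i < Suc m then Suc m - 1 - i else i) j)"
    using Suc.prems by (intro eq_matI) auto
  finally have "rows_det d ?g
      = (-1) ^ m * rows_det d (\<lambda>i. f (if i < Suc m then Suc m - 1 - i else i))"
    unfolding rows_det_def by simp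
  thus ?case using Suc by (simp add: numeral_2_eq_2 power_add)
qed (simp add: numeral_2_eq_2)

lemma rows_det_zero_column:
  assumes "j < d" and "\<And>i. i < d \<Longrightarrow> f i j = 0"
  shows "rows_det d f = 0"
proof -
  have "rows_det d f = (\<Sum>i<d. mat d d (\<lambda>(i, j). f i j) $$ (i, j) * cofactor (mat d d (\<lambda>(i, j). f i j)) i j)"
    unfolding rows_det_def using assms by (intro laplace_expansion_column) auto
  also have "\<dots> = 0" using assms by (intro sum.neutral) auto
  finally show ?thesis .
qed

lemma det_two:
  assumes "A \<in> carrier_mat 2 2"
  shows "det A = A $$ (0, 0) * A $$ (1, 1) - A $$ (0, 1) * A $$ (1, 0)"
proof -
  have d: "det (mat_delete A i j) = mat_delete A i j $$ (0, 0)" for i j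
    using assms by (intro det_single) (auto simp: mat_delete_def)
  have "det A = (\<Sum>i<2. A $$ (i, 0) * cofactor A i 0)"
    using assms by (intro laplace_expansion_column) auto
  also have "\<dots> = A $$ (0, 0) * A $$ (1, 1) - A $$ (0, 1) * A $$ (1, 0)"
    using assms by (simp add: numeral_2_eq_2 cofactor_def d) (simp add: mat_delete_def)
  finally show ?thesis .
qed

lemma rows_det_canonical:
  fixes f :: "nat \<Rightarrow> nat \<Rightarrow> 'a::idom"
  assumes top: "\<And>i a. i < k \<Longrightarrow> a < k \<Longrightarrow> f i a = (if a = i then u else 0)"
    and low: "\<And>a. a < k \<Longrightarrow> f k a = 0" "\<And>a. a < k \<Longrightarrow> f (Suc k) a = 0"
  shows "rows_det (k + 2) f
    = u ^ k * (f k k * f (Suc k) (Suc k) - f k (Suc k) * f (Suc k) k)"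
proof -
  let ?B = "mat 2 2 (\<lambda>(i, j). f (k + i) (k + j))"
  have "mat (k + 2) (k + 2) (\<lambda>(i, j). f i j) = four_block_mat (u \<cdot>\<^sub>m 1\<^sub>m k)
      (mat k 2 (\<lambda>(i, j). f i (k + j))) (0\<^sub>m 2 k) ?B"
  proof (rule eq_matI)
    fix i j assume "i < dim_row (four_block_mat (u \<cdot>\<^sub>m 1\<^sub>m k)
      (mat k 2 (\<lambda>(i, j). f i (k + j))) (0\<^sub>m 2 k) ?B)"
      "j < dim_col (four_block_mat (u \<cdot>\<^sub>m 1\<^sub>m k)
      (mat k 2 (\<lambda>(i, j). f i (k + j))) (0\<^sub>m 2 k) ?B)"
    hence ij: "i < k + 2" "j < k + 2" by auto
    have "i < k \<or> i = k \<or> i = Suc k" using ij by auto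
    thus "mat (k + 2) (k + 2) (\<lambda>(i, j). f i j) $$ (i, j) = four_block_mat (u \<cdot>\<^sub>m 1\<^sub>m k)
      (mat k 2 (\<lambda>(i, j). f i (k + j))) (0\<^sub>m 2 k) ?B $$ (i, j)"
      using ij top low by auto
  qed auto
  hence "rows_det (k + 2) f = det (u \<cdot>\<^sub>m 1\<^sub>m k) * det ?B"
    unfolding rows_det_def
    by (simp only:, subst det_four_block_mat_lower_left_zero[of _ k _ 2]) auto
  also have "det ?B = f k k * f (Suc k) (Suc k) - f k (Suc k) * f (Suc k) k"
    by (subst det_two) auto
  finally show ?thesis by simp
qed

section \<open>Reduction to a determinant of size k + 2\<close>

text \<open>Reduction modulo the double root \<open>-c\<close> keeps exactly the value and the first derivative.\<close>

lemma linear_Taylor: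
  fixes q :: "'a::field poly"
  shows "\<exists>s. q = [:poly q (-c):] + smult (poly (pderiv q) (-c)) [:c, 1:] + [:c, 1:] ^ 2 * s"
proof -
  have div: "\<exists>s. f = [:poly f (-c):] + [:c, 1:] * s" for f :: "'a poly"
  proof -
    have "poly (f - [:poly f (-c):]) (-c) = 0" by simp
    hence "[:c, 1:] dvd f - [:poly f (-c):]" using poly_eq_0_iff_dvd[of "f - [:poly f (-c):]" "-c"] by simp
    then obtain s where "f - [:poly f (-c):] = [:c, 1:] * s" by (elim dvdE)
    thus ?thesis by (metis add.commute diff_add_cancel)
  qed
  obtain s where s: "q = [:poly q (-c):] + [:c, 1:] * s" using div by blast
  obtain t where t: "s = [:poly s (-c):] + [:c, 1:] * t" using div by blast
  have "pderiv q = s + [:c, 1:] * pderiv s"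
    by (subst s) (simp add: pderiv_add pderiv_mult pderiv_pCons pderiv_smult)
  hence "poly (pderiv q) (-c) = poly s (-c)" by simp
  moreover have "q = [:poly q (-c):] + smult (poly s (-c)) [:c, 1:] + [:c, 1:] ^ 2 * t"
  proof -
    have "x * ([:b:] + x * t) = smult b x + x ^ 2 * t" for x :: "'a poly" and b
      by (simp add: power2_eq_square algebra_simps)
    from this[of "[:c, 1:]" "poly s (-c)"]
    have "smult (poly s (-c)) [:c, 1:] + [:c, 1:] ^ 2 * t = [:c, 1:] * s"
      unfolding t[symmetric] by (rule sym)
    thus ?thesis using s unfolding add.assoc by (simp only:)
  qed
  ultimately show ?thesis by metis
qed

text \<open>The remainders modulo \<open>[:c, 1:] ^ 2 * V k\<close> are written in the basis \<open>V 0, \<dots>, V (k - 1)\<close>,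
\<open>V k\<close>, \<open>[:c, 1:] * V k\<close>. Their first \<open>k\<close> coordinates are the remainder modulo \<open>V k\<close>, the last two describe the
quotient \<open>q i\<close> to first order at \<open>-c\<close>.\<close>

lemma H_eq_det_mod_V:
  fixes c :: "'a::field"
  assumes V: "\<And>i. i < k + 2 \<Longrightarrow> V (N + i) = (\<Sum>a<k. smult (R i a) (V a)) + V k * q i"
  shows "H c k N = (-1) ^ (N * (k + 2)) * rows_det (k + 2) (\<lambda>i a. if a < k then R i a
    else if a = k then poly (q i) (-c) else poly (pderiv (q i)) (-c))"
proof -
  let ?X = "[:c, 1:]"
  define C where "C i a = (if a < k then R i a
    else if a = k then poly (q i) (-c) else poly (pderiv (q i)) (-c))" for i a
  define e where "e a = (if a < k then V a else ?X ^ (a - k) * V k)" for a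
  have "\<forall>i. \<exists>s. q i = [:poly (q i) (-c):] + smult (poly (pderiv (q i)) (-c)) ?X + ?X ^ 2 * s"
    using linear_Taylor by blast
  from choice[OF this] obtain s where
    s: "\<And>i. q i = [:poly (q i) (-c):] + smult (poly (pderiv (q i)) (-c)) ?X + ?X ^ 2 * s i"
    by blast
  have degV: "degree (V n :: 'a poly) = n" "coeff (V n :: 'a poly) n = 1" for n
    using V_degree by auto
  have lin: "coeff (?X ^ n * V k) (n + k) = 1" "degree (?X ^ n * V k) = n + k" for n
  proof -
    show "degree (?X ^ n * V k) = n + k"
      using degV[of k] by (subst degree_mult_eq) (auto simp: degree_linear_power)
    show "coeff (?X ^ n * V k) (n + k) = 1"
      using coeff_mult_degree_sum[of "?X ^ n" "V k"] degV[of k]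
      by (simp add: degree_linear_power coeff_linear_power)
  qed
  have "V (N + i) = (\<Sum>a<k + 2. smult (C i a) (e a)) + (?X ^ 2 * V k) * s i" if "i < k + 2" for i
  proof -
    have "(\<Sum>a<k + 2. smult (C i a) (e a)) + (?X ^ 2 * V k) * s i = (\<Sum>a<k. smult (R i a) (V a))
        + V k * ([:poly (q i) (-c):] + smult (poly (pderiv (q i)) (-c)) ?X + ?X ^ 2 * s i)"
      by (simp add: C_def e_def smult_add_left smult_add_right algebra_simps)
    thus ?thesis unfolding s[symmetric] using V[OF that] by simp
  qed
  note C = this
  have "det (mat N N (\<lambda>(i, j). moment (?X ^ 2 * V k * ?X ^ i * ?X ^ j)))
    = (-1) ^ (N * (k + 2)) * det (mat (k + 2) (k + 2) (\<lambda>(i, a). C i a))"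
  proof (rule V.det_Christoffel[OF _ _ _ monic_family_power C])
    show "coeff (?X ^ 2 * V k) (k + 2) = 1" using lin[of 2] by (simp add: add.commute)
    show "\<forall>i>k + 2. coeff (?X ^ 2 * V k) i = 0"
      using lin[of 2] by (auto intro!: coeff_eq_0)
    show "coeff (e a) a = 1 \<and> (\<forall>i>a. coeff (e a) i = 0)" for a
      using degV[of a] lin[of "a - k"] by (auto simp: e_def intro!: coeff_eq_0)
  qed
  moreover have "mat N N (\<lambda>(i, j). moment (?X ^ 2 * V k * ?X ^ i * ?X ^ j))
      = mat N N (\<lambda>(i, j). Cat_bc 1 c (i + j + 2) k)"
  proof (rule eq_matI)
    fix i j assume ij: "i < dim_row (mat N N (\<lambda>(i, j). Cat_bc 1 c (i + j + 2) k))"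
      "j < dim_col (mat N N (\<lambda>(i, j). Cat_bc 1 c (i + j + 2) k))"
    have "?X ^ 2 * V k * ?X ^ i * ?X ^ j = ?X ^ (i + j + 2) * V k"
      unfolding power_add by (simp only: mult_ac)
    thus "mat N N (\<lambda>(i, j). moment (?X ^ 2 * V k * ?X ^ i * ?X ^ j)) $$ (i, j)
      = mat N N (\<lambda>(i, j). Cat_bc 1 c (i + j + 2) k) $$ (i, j)"
      using ij by (simp only: dim_row_mat dim_col_mat index_mat prod.case moment_power_V)
  qed auto
  ultimately show ?thesis by (simp add: H_def rows_det_def C_def)
qed

text \<open>The coefficient of \<open>V a\<close> in the remainder of \<open>V p\<close> modulo \<open>V k\<close>. The sign comes from the shifts
by \<open>2 * k + 1\<close>, the two cases from the reflection that exchanges \<open>m\<close> and \<open>2 * k - m\<close>; for the fixed point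
\<open>m = k\<close> the remainder is \<open>0\<close>, in accordance with the restriction to \<open>a < k\<close>.\<close>

definition rem_coeff :: "nat \<Rightarrow> nat \<Rightarrow> nat \<Rightarrow> 'a::comm_ring_1" where
  "rem_coeff k p a = (-1) ^ (p div (2 * k + 1)) *
     (if p mod (2 * k + 1) = a then 1 else if p mod (2 * k + 1) + a = 2 * k then -1 else 0)"

definition quot :: "nat \<Rightarrow> nat \<Rightarrow> 'a::field poly" where
  "quot k p = (V p - (\<Sum>a<k. smult (rem_coeff k p a) (V a))) div V k"

lemma V_nonzero: "V k \<noteq> (0 :: 'a::field poly)"
  using V_degree[of k, where 'a = 'a] by force

lemma rem_coeff_eq:
  assumes "m \<le> 2 * k"
  shows "rem_coeff k ((2 * k + 1) * n + m) a
    = (-1) ^ n * (if m = a then 1 else if m + a = 2 * k then -1 else 0)"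
proof -
  have "(M * n + m) div M = n" "(M * n + m) mod M = m" if "m < M" for M
    using that by auto
  from this[of "2 * k + 1"] show ?thesis using assms by (simp only: rem_coeff_def)
qed

lemma sum_unit:
  assumes "b < k"
  shows "(\<Sum>a<k. smult (if b = a then u else 0) (V a)) = smult u (V b)"
proof -
  have "(\<Sum>a<k. smult (if b = a then u else 0) (V a)) = (\<Sum>a<k. if b = a then smult u (V a) else 0)"
    by (intro sum.cong) auto
  thus ?thesis using assms by simp
qed

lemma V_dvd_remainder:
  fixes k p :: nat
  shows "(V k :: 'a::field poly) dvd V p - (\<Sum>a<k. smult (rem_coeff k p a) (V a))"
proof (induction p rule: less_induct)
  case (less p)
  let ?M = "2 * k + 1"
  show ?case
  proof (cases "p < ?M")
    case False
    define p' where "p' = p - ?M"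
    have p: "p = p' + 2 * k + 1" "p' < p" using False by (auto simp: p'_def)
    have "rem_coeff k p a = (- rem_coeff k p' a :: 'a)" for a
    proof -
      have "p div ?M = Suc (p' div ?M)" "p mod ?M = p' mod ?M"
        unfolding p(1) add.assoc by (simp_all only: div_add_self2 mod_add_self2)
      thus ?thesis by (simp only: rem_coeff_def power_Suc) simp
    qed
    hence "V p - (\<Sum>a<k. smult (rem_coeff k p a) (V a)) + (V p' - (\<Sum>a<k. smult (rem_coeff k p' a) (V a)))
        = (V p + V p' :: 'a poly)"
      by (simp add: sum_negf)
    also have "\<dots> = V k * L (p' + k + 1)" using V_shift[of p' k] p by (simp add: mult.commute)
    finally have "V k dvd V p - (\<Sum>a<k. smult (rem_coeff k p a) (V a))
        + (V p' - (\<Sum>a<k. smult (rem_coeff k p' a) (V a :: 'a poly)))"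
      by (simp only: dvd_triv_left)
    thus ?thesis by (simp only: dvd_add_left_iff[OF less.IH[OF p(2)]])
  next
    case True
    hence rc: "rem_coeff k p a = (if p = a then 1 else if p + a = 2 * k then -1 else 0 :: 'a)" for a
      using rem_coeff_eq[of p k 0 a] by simp
    consider "p < k" | "p = k" | "k < p" by linarith
    thus ?thesis
    proof cases
      case 1
      hence "(\<Sum>a<k. smult (rem_coeff k p a) (V a)) = (\<Sum>a<k. smult (if p = a then 1 else 0) (V a :: 'a poly))"
        by (intro sum.cong) (auto simp: rc)
      thus ?thesis using 1 by (simp add: sum_unit)
    next
      case 2
      have "(\<Sum>a<k. smult (rem_coeff k p a) (V a :: 'a poly)) = 0"
        using rc 2 by (intro sum.neutral) auto
      thus ?thesis using 2 by simp
    next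
      case 3
      define b where "b = 2 * k - p"
      have b: "b < k" "p + b = 2 * k" using 3 True by (auto simp: b_def)
      have "(\<Sum>a<k. smult (rem_coeff k p a) (V a)) = (\<Sum>a<k. smult (if b = a then -1 else 0) (V a :: 'a poly))"
        using b 3 by (intro sum.cong) (auto simp: rc)
      also have "\<dots> = - V b" using b by (simp add: sum_unit)
      finally have "V p - (\<Sum>a<k. smult (rem_coeff k p a) (V a)) = (V p + V b :: 'a poly)" by simp
      also have "\<dots> = V k * L (p - k)"
      proof -
        have e: "p - k \<le> k" "k + (p - k) = p" "k - (p - k) = b"
          using 3 True by (auto simp: b_def)
        show ?thesis
          using V_add_sub[OF e(1), where 'a = 'a] unfolding e(2,3) by (simp add: mult.commute)
      qed
      finally show ?thesis by simp
    qed
  qed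
qed

lemma smult_sum_right: "smult s (\<Sum>a\<in>A. f a) = (\<Sum>a\<in>A. smult s (f a))"
  by (induction A rule: infinite_finite_induct) (simp_all add: smult_add_right)

lemma V_decomp: "V p = (\<Sum>a<k. smult (rem_coeff k p a) (V a)) + V k * quot k p"
  by (simp add: quot_def dvd_mult_div_cancel[OF V_dvd_remainder])

text \<open>A combination whose remainders cancel can be divided by \<open>V k\<close> exactly. This is how every quotient below
is identified.\<close>

lemma quot_relation:
  fixes s :: "'a::field"
  assumes "\<And>a. a < k \<Longrightarrow> rem_coeff k p a + s * rem_coeff k p' a = 0"
  shows "V k * (quot k p + smult s (quot k p')) = V p + smult s (V p')"
proof -
  have "V p + smult s (V p') = (\<Sum>a<k. smult (rem_coeff k p a + s * rem_coeff k p' a) (V a))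
      + V k * (quot k p + smult s (quot k p'))"
    by (subst V_decomp[of p k], subst V_decomp[of p' k])
       (simp add: smult_add_right smult_add_left sum.distrib smult_sum_right algebra_simps)
  also have "(\<Sum>a<k. smult (rem_coeff k p a + s * rem_coeff k p' a) (V a)) = 0"
    using assms by (intro sum.neutral) auto
  finally show ?thesis by simp
qed

text \<open>The coordinates of \<open>V p\<close> modulo the weight: remainder modulo \<open>V k\<close>, then value and derivative
at \<open>-c\<close> of the quotient.\<close>

definition coord :: "nat \<Rightarrow> 'a::field \<Rightarrow> nat \<Rightarrow> nat \<Rightarrow> 'a" where
  "coord k c p a = (if a < k then rem_coeff k p a
     else if a = k then poly (quot k p) (-c) else poly (pderiv (quot k p)) (-c))"

lemma H_eq_rows_det_coord: "H c k N = (-1) ^ (N * k) * rows_det (k + 2) (\<lambda>i. coord k c (N + i))"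
proof -
  have "H c k N = (-1) ^ (N * (k + 2)) * rows_det (k + 2) (\<lambda>i. coord k c (N + i))"
    unfolding coord_def[abs_def] by (rule H_eq_det_mod_V) (rule V_decomp)
  moreover have "(-1 :: 'a) ^ (N * (k + 2)) = (-1) ^ (N * k)"
    by (simp add: power_add distrib_left power_mult)
  ultimately show ?thesis by simp
qed

section \<open>The quotients\<close>

abbreviation qval :: "nat \<Rightarrow> 'a::field \<Rightarrow> nat \<Rightarrow> 'a" where
  "qval k c p \<equiv> coord k c p k"

abbreviation qder :: "nat \<Rightarrow> 'a::field \<Rightarrow> nat \<Rightarrow> 'a" where
  "qder k c p \<equiv> coord k c p (Suc k)"

lemma coord_rem:
  assumes "a < k" and "m \<le> 2 * k"
  shows "coord k c ((2 * k + 1) * n + m) a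
    = (-1) ^ n * (if m = a then 1 else if m + a = 2 * k then -1 else 0)"
  unfolding coord_def rem_coeff_eq[OF assms(2)] using assms(1) by simp

lemma quot_mid: "V k * quot k ((2 * k + 1) * n + k) = V ((2 * k + 1) * n + k)"
proof -
  have "rem_coeff k ((2 * k + 1) * n + k) a + 0 * rem_coeff k 0 a = (0 :: 'a)" if "a < k" for a
    using that by (subst rem_coeff_eq) auto
  from quot_relation[of k _ 0 0, OF this] show ?thesis by simp
qed

lemma quot_mid_neighbours:
  assumes "1 \<le> k"
  shows "quot k ((2 * k + 1) * n + (k + 1)) + quot k ((2 * k + 1) * n + (k - 1))
    = yvar * (quot k ((2 * k + 1) * n + k) :: 'a::field poly)"
proof -
  obtain j where k: "k = Suc j" using assms by (cases k) auto
  let ?p = "(2 * k + 1) * n"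
  have "rem_coeff k (?p + (k + 1)) a + 1 * rem_coeff k (?p + (k - 1)) a = (0 :: 'a)" if "a < k" for a
    using that assms by (subst (1 2) rem_coeff_eq) auto
  hence "V k * (quot k (?p + (k + 1)) + smult 1 (quot k (?p + (k - 1))))
      = V (?p + (k + 1)) + smult (1 :: 'a) (V (?p + (k - 1)))"
    by (rule quot_relation)
  also have "\<dots> = yvar * V (?p + k)"
    using V_rec[of "?p + j", where 'a = 'a] by (simp add: k)
  also have "\<dots> = V k * (yvar * quot k (?p + k))"
    unfolding quot_mid[symmetric] by (simp only: mult_ac)
  finally have "V k * (quot k (?p + (k + 1)) + quot k (?p + (k - 1))) = V k * (yvar * (quot k (?p + k) :: 'a poly))"
    by simp
  thus ?thesis using V_nonzero[of k] mult_left_cancel by blast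
qed

text \<open>The remainders at \<open>2 * k - j\<close> in one period and at \<open>j\<close> in the next agree: the sign of the reflection and
that of the shift cancel.\<close>

lemma quot_diff_around:
  assumes "j < k"
  shows "V k * (quot k ((2 * k + 1) * (n + 1) + j) - quot k ((2 * k + 1) * n + (2 * k - j)))
    = W j * (V ((2 * k + 1) * (n + 1)) - V ((2 * k + 1) * n + 2 * k) :: 'a::field poly)"
proof -
  let ?p = "(2 * k + 1) * (n + 1) + j" and ?p' = "(2 * k + 1) * n + (2 * k - j)"
  have "rem_coeff k ?p a + (-1) * rem_coeff k ?p' a = (0 :: 'a)" if "a < k" for a
    using that assms by (subst (1 2) rem_coeff_eq) auto
  hence "V k * (quot k ?p + smult (-1) (quot k ?p')) = V ?p + smult (-1 :: 'a) (V ?p')"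
    by (rule quot_relation)
  moreover have "V ?p - V ?p' = W j * (V ((2 * k + 1) * (n + 1)) - V ((2 * k + 1) * n + 2 * k) :: 'a poly)"
    using V_diff_around[of j "(2 * k + 1) * n + 2 * k", where 'a = 'a] assms
    by (simp add: algebra_simps)
  ultimately show ?thesis by simp
qed

text \<open>The quotient by \<open>V k\<close> of the difference of \<open>V\<close> at the last index of one period and the first index of
the next, where the remainders agree.\<close>

definition gap :: "nat \<Rightarrow> nat \<Rightarrow> 'a::field poly" where
  "gap k n = quot k ((2 * k + 1) * (n + 1)) - quot k ((2 * k + 1) * n + 2 * k)"

lemma V_mult_gap:
  assumes "1 \<le> k"
  shows "V k * gap k n = V ((2 * k + 1) * (n + 1)) - V ((2 * k + 1) * n + 2 * k)"
  using quot_diff_around[of 0 k n] assms by (simp add: gap_def W_0)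

lemma quot_diff_next:
  assumes "2 \<le> k"
  shows "quot k ((2 * k + 1) * (n + 1) + 1) - quot k ((2 * k + 1) * n + (2 * k - 1))
    = (yvar + 1) * (gap k n :: 'a::field poly)"
proof -
  have "V k * (quot k ((2 * k + 1) * (n + 1) + 1) - quot k ((2 * k + 1) * n + (2 * k - 1)))
      = V k * ((yvar + 1) * (gap k n :: 'a poly))"
    using quot_diff_around[of 1 k n, where 'a = 'a] assms
    by (simp only: mult.left_commute[of "V k"] V_mult_gap) (simp add: W_1)
  thus ?thesis using V_nonzero[of k] mult_left_cancel by blast
qed

lemma quot_mid_diff:
  assumes "1 \<le> k"
  shows "quot k ((2 * k + 1) * (n + 1) + k) - quot k ((2 * k + 1) * n + k)
    = W k * (gap k n :: 'a::field poly)"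
proof -
  have "V ((2 * k + 1) * (n + 1) + k) - V ((2 * k + 1) * n + k)
     = W k * (V ((2 * k + 1) * (n + 1)) - V ((2 * k + 1) * n + 2 * k) :: 'a poly)"
    using V_diff_around[of k "(2 * k + 1) * n + 2 * k", where 'a = 'a]
    by (simp add: algebra_simps)
  hence "V k * (quot k ((2 * k + 1) * (n + 1) + k) - quot k ((2 * k + 1) * n + k))
      = V k * (W k * (gap k n :: 'a poly))"
    using assms
    by (simp only: mult.left_commute[of "V k"] V_mult_gap right_diff_distrib quot_mid)
  thus ?thesis using V_nonzero[of k] mult_left_cancel by blast
qed

lemma poly_yvar [simp]: "poly yvar x = x" "pderiv yvar = 1"
  by (simp_all add: yvar_def pderiv_pCons)

lemma coord_k: "qval k c p = poly (quot k p) (-c)" and coord_Suc_k: "qder k c p = poly (pderiv (quot k p)) (-c)"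
  by (simp_all add: coord_def)

lemma q_neighbours:
  assumes "1 \<le> k"
  shows "qval k c ((2 * k + 1) * n + (k + 1)) = - c * qval k c ((2 * k + 1) * n + k) - qval k c ((2 * k + 1) * n + (k - 1))"
    and "qder k c ((2 * k + 1) * n + (k + 1)) = qval k c ((2 * k + 1) * n + k)
      - c * qder k c ((2 * k + 1) * n + k) - qder k c ((2 * k + 1) * n + (k - 1))"
proof -
  have q: "quot k ((2 * k + 1) * n + (k + 1)) = yvar * quot k ((2 * k + 1) * n + k) - (quot k ((2 * k + 1) * n + (k - 1)) :: 'a poly)"
    unfolding quot_mid_neighbours[OF assms, symmetric] by simp
  show "qval k c ((2 * k + 1) * n + (k + 1)) = - c * qval k c ((2 * k + 1) * n + k) - qval k c ((2 * k + 1) * n + (k - 1))"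
    unfolding coord_k q poly_diff poly_mult poly_yvar ..
  show "qder k c ((2 * k + 1) * n + (k + 1)) = qval k c ((2 * k + 1) * n + k)
      - c * qder k c ((2 * k + 1) * n + k) - qder k c ((2 * k + 1) * n + (k - 1))"
    unfolding coord_k coord_Suc_k q pderiv_diff pderiv_mult poly_diff poly_mult poly_yvar
    by (simp add: pderiv_mult)
qed

lemma q_gap:
  fixes c :: "'a::field"
  assumes "1 \<le> k"
  shows "qval k c ((2 * k + 1) * (n + 1)) = poly (gap k n) (-c) + qval k c ((2 * k + 1) * n + 2 * k)"
    and "qder k c ((2 * k + 1) * (n + 1)) = poly (pderiv (gap k n)) (-c) + qder k c ((2 * k + 1) * n + 2 * k)"
  unfolding coord_k coord_Suc_k gap_def pderiv_diff poly_diff by simp_all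

lemma q_next:
  assumes "2 \<le> k"
  shows "qval k c ((2 * k + 1) * (n + 1) + 1) = (1 - c) * poly (gap k n) (-c) + qval k c ((2 * k + 1) * n + (2 * k - 1))"
    and "qder k c ((2 * k + 1) * (n + 1) + 1) = poly (gap k n) (-c) + (1 - c) * poly (pderiv (gap k n)) (-c)
      + qder k c ((2 * k + 1) * n + (2 * k - 1))"
proof -
  have q: "quot k ((2 * k + 1) * (n + 1) + 1) = (yvar + 1) * gap k n + (quot k ((2 * k + 1) * n + (2 * k - 1)) :: 'a poly)"
    unfolding quot_diff_next[OF assms, symmetric] by simp
  show "qval k c ((2 * k + 1) * (n + 1) + 1) = (1 - c) * poly (gap k n) (-c) + qval k c ((2 * k + 1) * n + (2 * k - 1))"
    unfolding coord_k q poly_add poly_mult poly_yvar by simp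
  show "qder k c ((2 * k + 1) * (n + 1) + 1) = poly (gap k n) (-c) + (1 - c) * poly (pderiv (gap k n)) (-c)
      + qder k c ((2 * k + 1) * n + (2 * k - 1))"
    unfolding coord_Suc_k q pderiv_add pderiv_mult poly_add poly_mult poly_yvar
    by (simp add: algebra_simps)
qed

lemma q_mid_diff:
  assumes "1 \<le> k"
  shows "qval k c ((2 * k + 1) * (n + 1) + k) = poly (W k) (-c) * poly (gap k n) (-c) + qval k c ((2 * k + 1) * n + k)"
    and "qder k c ((2 * k + 1) * (n + 1) + k) = poly (pderiv (W k)) (-c) * poly (gap k n) (-c)
      + poly (W k) (-c) * poly (pderiv (gap k n)) (-c) + qder k c ((2 * k + 1) * n + k)"
proof -
  have q: "quot k ((2 * k + 1) * (n + 1) + k) = W k * gap k n + (quot k ((2 * k + 1) * n + k) :: 'a poly)"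
    unfolding quot_mid_diff[OF assms, symmetric] by simp
  show "qval k c ((2 * k + 1) * (n + 1) + k) = poly (W k) (-c) * poly (gap k n) (-c) + qval k c ((2 * k + 1) * n + k)"
    unfolding coord_k q poly_add poly_mult ..
  show "qder k c ((2 * k + 1) * (n + 1) + k) = poly (pderiv (W k)) (-c) * poly (gap k n) (-c)
      + poly (W k) (-c) * poly (pderiv (gap k n)) (-c) + qder k c ((2 * k + 1) * n + k)"
    unfolding coord_Suc_k q pderiv_add pderiv_mult poly_add poly_mult
    by (simp add: algebra_simps)
qed

section \<open>The determinants at each residue\<close>

lemma choose_two_Suc: "Suc k choose 2 = (k choose 2) + k"
  by (simp add: numeral_2_eq_2)

text \<open>Up to a common sign the first \<open>k\<close> remainders are \<open>V 0, \<dots>, V (k - 1)\<close> in order. The remainder of the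
middle row \<open>k\<close> is \<open>0\<close>, and that of its successor is cancelled by row \<open>k - 1\<close>.\<close>

lemma H_residue_0:
  fixes c :: "'a::field"
  assumes k: "1 \<le> k"
  shows "H c k ((2 * k + 1) * n) = qval k c ((2 * k + 1) * n + k) ^ 2"
proof -
  let ?M = "2 * k + 1"
  define f where "f i = coord k c (?M * n + i)" for i
  define g where "g = f(Suc k := \<lambda>a. f (Suc k) a + 1 * f (k - 1) a)"
  have "rows_det (k + 2) g = rows_det (k + 2) f"
    unfolding g_def using k by (intro rows_det_add_row) auto
  moreover have "rows_det (k + 2) g = ((-1) ^ n) ^ k * (g k k * g (Suc k) (Suc k) - g k (Suc k) * g (Suc k) k)"
  proof (rule rows_det_canonical)
    fix i a assume "i < k" "a < k"
    thus "g i a = (if a = i then (- 1) ^ n else 0)"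
      using coord_rem[of a k i c n] by (auto simp: g_def f_def)
  next
    fix a assume a: "a < k"
    thus "g k a = 0" using coord_rem[of a k k c n] by (auto simp: g_def f_def)
    show "g (Suc k) a = 0" using a k coord_rem[of a k "k + 1" c n] coord_rem[of a k "k - 1" c n]
      by (auto simp: g_def f_def)
  qed
  moreover have "g k k * g (Suc k) (Suc k) - g k (Suc k) * g (Suc k) k = qval k c (?M * n + k) ^ 2"
  proof -
    have 1: "g (Suc k) k = - c * qval k c (?M * n + k)"
      "g (Suc k) (Suc k) = qval k c (?M * n + k) - c * qder k c (?M * n + k)"
      using q_neighbours[OF k, of c n] by (simp_all add: g_def f_def)
    have 2: "g k k = qval k c (?M * n + k)" "g k (Suc k) = qder k c (?M * n + k)"
      by (simp_all add: g_def f_def)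
    show ?thesis unfolding 1 2 by (simp add: algebra_simps power2_eq_square)
  qed
  \<comment> \<open>\<open>?M\<close> is odd, so the sign of the Christoffel formula cancels that of the \<open>k\<close> unit vectors.\<close>
  moreover have "(-1 :: 'a) ^ (?M * n * k) * ((-1) ^ n) ^ k = 1"
    unfolding power_mult[symmetric] power_add[symmetric] by (simp add: minus_one_power_iff)
  ultimately show ?thesis
    using H_eq_rows_det_coord[of c k "?M * n"] unfolding f_def by (simp add: mult.assoc[symmetric])
qed

text \<open>The window runs from \<open>k - 1\<close> to \<open>2 * k\<close>. The remainders of rows \<open>0\<close> and \<open>2\<close> cancel; keeping row \<open>2\<close> as
the unit vector makes the window, read backwards, carry the uniform sign \<open>(-1) ^ Suc n\<close>.\<close>

lemma H_residue_k_minus_1: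
  fixes c :: "'a::field"
  assumes k: "1 \<le> k"
  shows "H c k ((2 * k + 1) * n + (k - 1)) = (-1) ^ ((k - 1) choose 2) * qval k c ((2 * k + 1) * n + k) ^ 2"
proof -
  let ?M = "2 * k + 1" and ?N = "(2 * k + 1) * n + (k - 1)"
  define f where "f i = coord k c (?N + i)" for i
  \<comment> \<open>\<open>V (k - 1) + V (k + 1) = y * V k\<close>, shifted by \<open>n\<close> periods\<close>
  define f1 where "f1 = f(0 := \<lambda>a. f 0 a + 1 * f 2 a)"
  define g where "g i = f1 (if i < k + 2 then k + 2 - 1 - i else i)" for i
  have "rows_det (k + 2) f = rows_det (k + 2) f1"
    unfolding f1_def using k by (intro rows_det_add_row[symmetric]) auto
  also have "\<dots> = (-1) ^ (k + 2 choose 2) * rows_det (k + 2) g"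
    unfolding g_def by (rule rows_det_reverse) simp
  also have "rows_det (k + 2) g = ((-1) ^ Suc n) ^ k * (g k k * g (Suc k) (Suc k) - g k (Suc k) * g (Suc k) k)"
  proof (rule rows_det_canonical)
    fix i a assume ia: "i < k" "a < k"
    have "g i a = coord k c (?M * n + (2 * k - i)) a"
    proof -
      have "k + 2 - 1 - i \<noteq> 0" "?N + (k + 2 - 1 - i) = ?M * n + (2 * k - i)" using ia k by auto
      thus ?thesis using ia unfolding g_def f1_def f_def by (simp only: fun_upd_apply) simp
    qed
    thus "g i a = (if a = i then (- 1) ^ Suc n else 0)"
      using ia coord_rem[of a k "2 * k - i" c n] by auto
  next
    fix a assume a: "a < k"
    have "g k a = coord k c (?M * n + k) a" using k by (simp add: g_def f1_def f_def)
    thus "g k a = 0" using a coord_rem[of a k k c n] by auto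
    have "g (Suc k) a = coord k c (?M * n + (k - 1)) a + coord k c (?M * n + (k + 1)) a"
      using k by (simp add: g_def f1_def f_def)
    thus "g (Suc k) a = 0" using a k coord_rem[of a k "k + 1" c n] coord_rem[of a k "k - 1" c n]
      by auto
  qed
  also have "g k k * g (Suc k) (Suc k) - g k (Suc k) * g (Suc k) k = qval k c (?M * n + k) ^ 2"
  proof -
    have 1: "g (Suc k) k = - c * qval k c (?M * n + k)"
      "g (Suc k) (Suc k) = qval k c (?M * n + k) - c * qder k c (?M * n + k)"
      using q_neighbours[OF k, of c n] k by (simp_all add: g_def f1_def f_def)
    have 2: "g k k = qval k c (?M * n + k)" "g k (Suc k) = qder k c (?M * n + k)"
      using k by (simp_all add: g_def f1_def f_def)
    show ?thesis unfolding 1 2 by (simp add: algebra_simps power2_eq_square)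
  qed
  finally have "H c k ?N = (-1) ^ (?N * k) * ((-1) ^ (k + 2 choose 2) * (((-1) ^ Suc n) ^ k
      * qval k c (?M * n + k) ^ 2))"
    using H_eq_rows_det_coord[of c k ?N] unfolding f_def by simp
  also have "\<dots> = (-1) ^ (?N * k + (k + 2 choose 2) + Suc n * k) * qval k c (?M * n + k) ^ 2"
    by (simp only: power_add power_mult mult.assoc)
  also have "(-1 :: 'a) ^ (?N * k + (k + 2 choose 2) + Suc n * k) = (-1) ^ ((k - 1) choose 2)"
  proof -
    obtain j where j: "k = Suc j" using k by (cases k) auto
    show ?thesis unfolding j minus_one_power_iff
      by (simp add: choose_two_Suc) (cases "even j"; cases "even n"; cases "even (j choose 2)"; simp)
  qed
  finally show ?thesis .
qed

text \<open>The window runs from the middle \<open>k\<close> to the first index of the next period. The last two rows have equal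
remainders, and the first \<open>k + 1\<close> rows are in reversed order.\<close>

lemma H_residue_k:
  fixes c :: "'a::field"
  assumes k: "1 \<le> k"
  shows "H c k ((2 * k + 1) * n + k) = (-1) ^ ((k + 1) choose 2) *
    (qval k c ((2 * k + 1) * n + k) * poly (pderiv (gap k n)) (-c)
      - qder k c ((2 * k + 1) * n + k) * poly (gap k n) (-c))"
proof -
  let ?M = "2 * k + 1" and ?N = "(2 * k + 1) * n + k"
  define f where "f i = coord k c (?N + i)" for i
  define f1 where "f1 = f(Suc k := \<lambda>a. f (Suc k) a + (-1) * f k a)"
  define g where "g i = f1 (if i < k + 1 then k + 1 - 1 - i else i)" for i
  have eqs: "?N + Suc k = ?M * (n + 1)" "?N + k = ?M * n + 2 * k" by simp_all
  have "rows_det (k + 2) f = rows_det (k + 2) f1"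
    unfolding f1_def using k by (intro rows_det_add_row[symmetric]) auto
  also have "\<dots> = (-1) ^ (k + 1 choose 2) * rows_det (k + 2) g"
    unfolding g_def by (rule rows_det_reverse) simp
  also have "rows_det (k + 2) g = ((-1) ^ Suc n) ^ k * (g k k * g (Suc k) (Suc k) - g k (Suc k) * g (Suc k) k)"
  proof (rule rows_det_canonical)
    fix i a assume ia: "i < k" "a < k"
    have "g i a = coord k c (?M * n + (2 * k - i)) a"
    proof -
      have "k + 1 - 1 - i \<noteq> Suc k" "?N + (k + 1 - 1 - i) = ?M * n + (2 * k - i)" using ia k by auto
      thus ?thesis using ia unfolding g_def f1_def f_def by (simp only: fun_upd_apply) simp
    qed
    thus "g i a = (if a = i then (- 1) ^ Suc n else 0)"
      using ia coord_rem[of a k "2 * k - i" c n] by auto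
  next
    fix a assume a: "a < k"
    have "g k a = coord k c (?M * n + k) a" using k by (simp add: g_def f1_def f_def)
    thus "g k a = 0" using a coord_rem[of a k k c n] by auto
    have "g (Suc k) a = coord k c (?M * (n + 1) + 0) a - coord k c (?M * n + 2 * k) a"
      unfolding g_def f1_def f_def using eqs by (simp add: add_ac)
    thus "g (Suc k) a = 0"
      using a k coord_rem[of a k 0 c "n + 1"] coord_rem[of a k "2 * k" c n] by auto
  qed
  also have "g k k * g (Suc k) (Suc k) - g k (Suc k) * g (Suc k) k
      = qval k c ?N * poly (pderiv (gap k n)) (-c) - qder k c ?N * poly (gap k n) (-c)"
  proof -
    have 1: "g (Suc k) a = coord k c (?M * (n + 1)) a - coord k c (?M * n + 2 * k) a" for a
      unfolding g_def f1_def f_def using eqs by (simp add: add_ac)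
    have 2: "g k a = coord k c ?N a" for a
      using k by (simp add: g_def f1_def f_def)
    show ?thesis unfolding 1 2 q_gap[OF k] by (simp add: algebra_simps)
  qed
  finally have "H c k ?N = (-1) ^ (?N * k) * ((-1) ^ (k + 1 choose 2) * (((-1) ^ Suc n) ^ k
      * (qval k c ?N * poly (pderiv (gap k n)) (-c) - qder k c ?N * poly (gap k n) (-c))))"
    using H_eq_rows_det_coord[of c k ?N] unfolding f_def by simp
  also have "\<dots> = (-1) ^ (?N * k + (k + 1 choose 2) + Suc n * k) *
      (qval k c ?N * poly (pderiv (gap k n)) (-c) - qder k c ?N * poly (gap k n) (-c))"
    by (simp only: power_add power_mult mult.assoc)
  also have "(-1 :: 'a) ^ (?N * k + (k + 1 choose 2) + Suc n * k) = (-1) ^ ((k + 1) choose 2)"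
    unfolding minus_one_power_iff
    by (simp add: choose_two_Suc) (cases "even k"; cases "even n"; cases "even (k choose 2)"; simp)
  finally show ?thesis .
qed

text \<open>The window has two indices in the next period, whose remainders repeat those of the two indices
before the period ends.\<close>

lemma H_residue_k_plus_1:
  fixes c :: "'a::field"
  assumes k: "2 \<le> k"
  shows "H c k ((2 * k + 1) * n + (k + 1)) = (-1) ^ ((k + 1) choose 2) * poly (gap k n) (-c) ^ 2"
proof -
  let ?M = "2 * k + 1" and ?N = "(2 * k + 1) * n + (k + 1)"
  define f where "f i = coord k c (?N + i)" for i
  define f1 where "f1 = f(k := \<lambda>a. f k a + (-1) * f (k - 1) a)"
  define f2 where "f2 = f1(Suc k := \<lambda>a. f1 (Suc k) a + (-1) * f1 (k - 2) a)"
  define g where "g i = f2 (if i < k then k - 1 - i else i)" for i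
  have eqs: "?N + k = ?M * (n + 1)" "?N + (k - 1) = ?M * n + 2 * k"
    "?N + Suc k = ?M * (n + 1) + 1" "?N + (k - 2) = ?M * n + (2 * k - 1)" using k by simp_all
  have "k - 2 \<noteq> k" using k by simp
  have "rows_det (k + 2) f = rows_det (k + 2) f1"
    unfolding f1_def using k by (intro rows_det_add_row[symmetric]) auto
  also have "\<dots> = rows_det (k + 2) f2"
    unfolding f2_def using k by (intro rows_det_add_row[symmetric]) auto
  also have "\<dots> = (-1) ^ (k choose 2) * rows_det (k + 2) g"
    unfolding g_def by (rule rows_det_reverse) simp
  also have "rows_det (k + 2) g = ((-1) ^ Suc n) ^ k * (g k k * g (Suc k) (Suc k) - g k (Suc k) * g (Suc k) k)"
  proof (rule rows_det_canonical)
    fix i a assume ia: "i < k" "a < k"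
    have "g i a = coord k c (?M * n + (2 * k - i)) a"
    proof -
      have "k - 1 - i \<noteq> Suc k" "k - 1 - i \<noteq> k" "?N + (k - 1 - i) = ?M * n + (2 * k - i)"
        using ia k by auto
      thus ?thesis using ia unfolding g_def f2_def f1_def f_def by (simp only: fun_upd_apply) simp
    qed
    thus "g i a = (if a = i then (- 1) ^ Suc n else 0)"
      using ia coord_rem[of a k "2 * k - i" c n] by auto
  next
    fix a assume a: "a < k"
    have "g k a = coord k c (?M * (n + 1) + 0) a - coord k c (?M * n + 2 * k) a"
      unfolding g_def f2_def f1_def f_def using eqs by (simp add: add_ac)
    thus "g k a = 0"
      using a k coord_rem[of a k 0 c "n + 1"] coord_rem[of a k "2 * k" c n] by auto
    have "g (Suc k) a = coord k c (?M * (n + 1) + 1) a - coord k c (?M * n + (2 * k - 1)) a"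
      unfolding g_def f2_def f1_def f_def using eqs k \<open>k - 2 \<noteq> k\<close> by simp
    thus "g (Suc k) a = 0"
      using a k coord_rem[of a k 1 c "n + 1"] coord_rem[of a k "2 * k - 1" c n] by auto
  qed
  also have "g k k * g (Suc k) (Suc k) - g k (Suc k) * g (Suc k) k = poly (gap k n) (-c) ^ 2"
  proof -
    have 1: "g (Suc k) a = coord k c (?M * (n + 1) + 1) a - coord k c (?M * n + (2 * k - 1)) a" for a
      unfolding g_def f2_def f1_def f_def using eqs k \<open>k - 2 \<noteq> k\<close> by simp
    have 2: "g k a = coord k c (?M * (n + 1)) a - coord k c (?M * n + 2 * k) a" for a
      unfolding g_def f2_def f1_def f_def using eqs by (simp add: add_ac)
    have "1 \<le> k" using k by simp
    show ?thesis unfolding 1 2 q_gap[OF \<open>1 \<le> k\<close>] q_next[OF k]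
      by (simp add: algebra_simps power2_eq_square)
  qed
  finally have "H c k ?N = (-1) ^ (?N * k) * ((-1) ^ (k choose 2) * (((-1) ^ Suc n) ^ k
      * poly (gap k n) (-c) ^ 2))"
    using H_eq_rows_det_coord[of c k ?N] unfolding f_def by simp
  also have "\<dots> = (-1) ^ (?N * k + (k choose 2) + Suc n * k) * poly (gap k n) (-c) ^ 2"
    by (simp only: power_add power_mult mult.assoc)
  also have "(-1 :: 'a) ^ (?N * k + (k choose 2) + Suc n * k) = (-1) ^ ((k + 1) choose 2)"
    unfolding minus_one_power_iff
    by (simp add: choose_two_Suc) (cases "even k"; cases "even n"; cases "even (k choose 2)"; simp)
  finally show ?thesis .
qed

text \<open>The window has two indices before the period ends. Their rows, cleared by the rows \<open>3\<close> and \<open>2\<close>, have to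
be moved to the end in reversed order: reversing all rows and then the first \<open>k\<close> does this.\<close>

lemma H_residue_2k_minus_1:
  fixes c :: "'a::field"
  assumes k: "2 \<le> k"
  shows "H c k ((2 * k + 1) * n + (2 * k - 1)) = - (poly (gap k n) (-c) ^ 2)"
proof -
  let ?M = "2 * k + 1" and ?N = "(2 * k + 1) * n + (2 * k - 1)"
  define f where "f i = coord k c (?N + i)" for i
  define f1 where "f1 = f(0 := \<lambda>a. f 0 a + (-1) * f 3 a)"
  define f2 where "f2 = f1(1 := \<lambda>a. f1 1 a + (-1) * f1 2 a)"
  define g1 where "g1 i = f2 (if i < k + 2 then k + 2 - 1 - i else i)" for i
  define g where "g i = g1 (if i < k then k - 1 - i else i)" for i
  have eqs: "?N + 3 = ?M * (n + 1) + 1" "?N + 2 = ?M * (n + 1)"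
    "?N + 1 = ?M * n + 2 * k" "?N + 0 = ?M * n + (2 * k - 1)" using k by simp_all
  have "rows_det (k + 2) f = rows_det (k + 2) f1"
    unfolding f1_def using k by (intro rows_det_add_row[symmetric]) auto
  also have "\<dots> = rows_det (k + 2) f2"
    unfolding f2_def using k by (intro rows_det_add_row[symmetric]) auto
  also have "\<dots> = (-1) ^ (k + 2 choose 2) * rows_det (k + 2) g1"
    unfolding g1_def by (rule rows_det_reverse) simp
  also have "rows_det (k + 2) g1 = (-1) ^ (k choose 2) * rows_det (k + 2) g"
    unfolding g_def by (rule rows_det_reverse) simp
  also have "rows_det (k + 2) g = ((-1) ^ Suc n) ^ k * (g k k * g (Suc k) (Suc k) - g k (Suc k) * g (Suc k) k)"
  proof (rule rows_det_canonical)
    fix i a assume ia: "i < k" "a < k"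
    have "g i a = coord k c (?M * (n + 1) + i) a"
    proof -
      have "k - 1 - i < k + 2" "k + 2 - 1 - (k - 1 - i) = i + 2" using ia by auto
      hence "g i = f2 (i + 2)" using ia by (simp only: g_def g1_def if_True)
      thus ?thesis using ia k by (simp add: f2_def f1_def f_def add_ac)
    qed
    thus "g i a = (if a = i then (- 1) ^ Suc n else 0)"
      using ia coord_rem[of a k i c "n + 1"] by auto
  next
    fix a assume a: "a < k"
    have "g k a = coord k c (?M * n + 2 * k) a - coord k c (?M * (n + 1) + 0) a"
      unfolding g_def g1_def f2_def f1_def f_def using eqs by (simp add: add_ac)
    thus "g k a = 0"
      using a k coord_rem[of a k 0 c "n + 1"] coord_rem[of a k "2 * k" c n] by auto
    have "g (Suc k) a = coord k c (?M * n + (2 * k - 1)) a - coord k c (?M * (n + 1) + 1) a"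
      unfolding g_def g1_def f2_def f1_def f_def using eqs k by (simp add: add_ac)
    thus "g (Suc k) a = 0"
      using a k coord_rem[of a k 1 c "n + 1"] coord_rem[of a k "2 * k - 1" c n] by auto
  qed
  also have "g k k * g (Suc k) (Suc k) - g k (Suc k) * g (Suc k) k = poly (gap k n) (-c) ^ 2"
  proof -
    have 1: "g (Suc k) a = coord k c (?M * n + (2 * k - 1)) a - coord k c (?M * (n + 1) + 1) a" for a
      unfolding g_def g1_def f2_def f1_def f_def using eqs k by (simp add: add_ac)
    have 2: "g k a = coord k c (?M * n + 2 * k) a - coord k c (?M * (n + 1)) a" for a
      unfolding g_def g1_def f2_def f1_def f_def using eqs by (simp add: add_ac)
    have "1 \<le> k" using k by simp
    show ?thesis unfolding 1 2 q_gap[OF \<open>1 \<le> k\<close>] q_next[OF k]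
      by (simp add: algebra_simps power2_eq_square)
  qed
  finally have "H c k ?N = (-1) ^ (?N * k) * ((-1) ^ (k + 2 choose 2) * ((-1) ^ (k choose 2) *
      (((-1) ^ Suc n) ^ k * poly (gap k n) (-c) ^ 2)))"
    using H_eq_rows_det_coord[of c k ?N] unfolding f_def by simp
  also have "\<dots> = (-1) ^ (?N * k + (k + 2 choose 2) + (k choose 2) + Suc n * k) * poly (gap k n) (-c) ^ 2"
    by (simp only: power_add power_mult mult.assoc)
  also have "(-1 :: 'a) ^ (?N * k + (k + 2 choose 2) + (k choose 2) + Suc n * k) = -1"
  proof -
    obtain j where j: "k = Suc j" using k by (cases k) auto
    show ?thesis unfolding j minus_one_power_iff
      by (simp add: choose_two_Suc) (cases "even j"; cases "even n"; cases "even (j choose 2)"; simp)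
  qed
  finally show ?thesis by simp
qed

text \<open>The first two rows have equal remainders. After subtraction the first row is moved just before the
last one by two reversals.\<close>

lemma H_residue_2k:
  fixes c :: "'a::field"
  assumes k: "1 \<le> k"
  shows "H c k ((2 * k + 1) * n + 2 * k)
    = poly (pderiv (gap k n)) (-c) * qval k c ((2 * k + 1) * (n + 1) + k)
      - poly (gap k n) (-c) * qder k c ((2 * k + 1) * (n + 1) + k)"
proof -
  let ?M = "2 * k + 1" and ?N = "(2 * k + 1) * n + 2 * k"
  let ?D = "poly (pderiv (gap k n)) (-c) * qval k c ((2 * k + 1) * (n + 1) + k)
      - poly (gap k n) (-c) * qder k c ((2 * k + 1) * (n + 1) + k)"
  define f where "f i = coord k c (?N + i)" for i
  define f1 where "f1 = f(0 := \<lambda>a. f 0 a + (-1) * f 1 a)"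
  define g1 where "g1 i = f1 (if i < k + 1 then k + 1 - 1 - i else i)" for i
  define g where "g i = g1 (if i < k then k - 1 - i else i)" for i
  have eqs: "?N + Suc k = ?M * (n + 1) + k" "?N + 1 = ?M * (n + 1)" by simp_all
  have "rows_det (k + 2) f = rows_det (k + 2) f1"
    unfolding f1_def using k by (intro rows_det_add_row[symmetric]) auto
  also have "\<dots> = (-1) ^ (k + 1 choose 2) * rows_det (k + 2) g1"
    unfolding g1_def by (rule rows_det_reverse) simp
  also have "rows_det (k + 2) g1 = (-1) ^ (k choose 2) * rows_det (k + 2) g"
    unfolding g_def by (rule rows_det_reverse) simp
  also have "rows_det (k + 2) g = ((-1) ^ Suc n) ^ k * (g k k * g (Suc k) (Suc k) - g k (Suc k) * g (Suc k) k)"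
  proof (rule rows_det_canonical)
    fix i a assume ia: "i < k" "a < k"
    have "g i a = coord k c (?M * (n + 1) + i) a"
    proof -
      have "k - 1 - i < k + 1" "k + 1 - 1 - (k - 1 - i) = i + 1" using ia by auto
      hence "g i = f1 (i + 1)" using ia by (simp only: g_def g1_def if_True)
      thus ?thesis using ia k by (simp add: f1_def f_def add_ac)
    qed
    thus "g i a = (if a = i then (- 1) ^ Suc n else 0)"
      using ia coord_rem[of a k i c "n + 1"] by auto
  next
    fix a assume a: "a < k"
    have "g k a = coord k c (?M * n + 2 * k) a - coord k c (?M * (n + 1) + 0) a"
      unfolding g_def g1_def f1_def f_def using eqs by (simp add: add_ac)
    thus "g k a = 0"
      using a k coord_rem[of a k 0 c "n + 1"] coord_rem[of a k "2 * k" c n] by auto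
    have "g (Suc k) a = coord k c (?M * (n + 1) + k) a"
      unfolding g_def g1_def f1_def f_def using eqs by (simp add: add_ac)
    thus "g (Suc k) a = 0" using a coord_rem[of a k k c "n + 1"] by auto
  qed
  also have "g k k * g (Suc k) (Suc k) - g k (Suc k) * g (Suc k) k = ?D"
  proof -
    have 1: "g (Suc k) a = coord k c (?M * (n + 1) + k) a" for a
      unfolding g_def g1_def f1_def f_def using eqs by (simp add: add_ac)
    have 2: "g k a = coord k c (?M * n + 2 * k) a - coord k c (?M * (n + 1)) a" for a
      unfolding g_def g1_def f1_def f_def using eqs by (simp add: add_ac)
    show ?thesis unfolding 1 2 q_gap[OF k] by (simp add: algebra_simps)
  qed
  finally have "H c k ?N = (-1) ^ (?N * k) * ((-1) ^ (k + 1 choose 2) * ((-1) ^ (k choose 2) *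
      (((-1) ^ Suc n) ^ k * ?D)))"
    using H_eq_rows_det_coord[of c k ?N] unfolding f_def by simp
  also have "\<dots> = (-1) ^ (?N * k + (k + 1 choose 2) + (k choose 2) + Suc n * k) * ?D"
    by (simp only: power_add power_mult mult.assoc)
  also have "(-1 :: 'a) ^ (?N * k + (k + 1 choose 2) + (k choose 2) + Suc n * k) = 1"
    unfolding minus_one_power_iff
    by (simp add: choose_two_Suc) (cases "even k"; cases "even n"; cases "even (k choose 2)"; simp)
  finally show ?thesis by simp
qed

text \<open>For \<open>r < k\<close> the window lies strictly between the indices \<open>0\<close> and \<open>2 * k\<close> of one period, so \<open>V 0\<close> does not
occur. For larger \<open>r\<close> it starts beyond \<open>k + 1\<close> and ends before the index \<open>k - 1\<close> of the next period, so \<open>V (k - 1)\<close>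
does not occur.\<close>

lemma H_residue_other:
  fixes c :: "'a::field"
  assumes r: "r \<le> 2 * k" "r \<notin> {0, k - 1, k, k + 1, 2 * k - 1, 2 * k}"
  shows "H c k ((2 * k + 1) * n + r) = 0"
proof -
  let ?M = "2 * k + 1"
  have "rows_det (k + 2) (\<lambda>i. coord k c (?M * n + r + i)) = 0"
  proof (cases "r < k")
    case True
    show ?thesis
    proof (rule rows_det_zero_column[of 0])
      fix i assume "i < k + 2"
      thus "coord k c (?M * n + r + i) 0 = 0"
        using r True coord_rem[of 0 k "r + i" c n] by (auto simp: add.assoc)
    qed simp
  next
    case False
    show ?thesis
    proof (rule rows_det_zero_column[of "k - 1"])
      fix i assume i: "i < k + 2"
      show "coord k c (?M * n + r + i) (k - 1) = 0"
      proof (cases "r + i \<le> 2 * k")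
        case True
        thus ?thesis using r False coord_rem[of "k - 1" k "r + i" c n] by (auto simp: add.assoc)
      next
        case F: False
        define m where "m = r + i - ?M"
        have m: "?M * n + r + i = ?M * (n + 1) + m" "m < k - 1" using F i r False
          by (auto simp: m_def)
        show ?thesis unfolding m(1) using m(2) coord_rem[of "k - 1" k m c "n + 1"] by auto
      qed
    qed simp
  qed
  thus ?thesis using H_eq_rows_det_coord[of c k "?M * n + r"] by simp
qed

section \<open>Evaluation\<close>

lemma poly_mid:
  fixes c :: "'a::field"
  shows "poly (W k) c * qval k c ((2 * k + 1) * n + k)
    = (-1) ^ n * poly (W ((2 * k + 1) * n + k)) c"
proof -
  have "poly (V k) (-c) * qval k c ((2 * k + 1) * n + k) = poly (V ((2 * k + 1) * n + k)) (-c)"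
    unfolding coord_k poly_mult[symmetric] quot_mid ..
  hence "(-1) ^ k * (poly (W k) c * qval k c ((2 * k + 1) * n + k))
      = (-1) ^ ((2 * k + 1) * n + k) * poly (W ((2 * k + 1) * n + k)) c"
    unfolding poly_V_minus by (simp only: mult.assoc)
  also have "(-1 :: 'a) ^ ((2 * k + 1) * n + k) = (-1) ^ k * (-1) ^ n"
    unfolding power_add[symmetric] minus_one_power_iff by simp
  finally show ?thesis by (simp add: mult.assoc)
qed

lemma qval_mid_squared:
  fixes c :: "'a::field"
  assumes nz: "poly (F (2 * k + 1)) c \<noteq> 0"
  shows "qval k c ((2 * k + 1) * n + k) ^ 2
    = (poly (F ((2 * k + 1) * n)) c / poly (F (2 * k + 1)) c
       + poly (F ((2 * k + 1) * (n + 1))) c / poly (F (2 * k + 1)) c) ^ 2"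
proof -
  let ?M = "2 * k + 1"
  have FM: "poly (F ?M) c = poly (V k) c * poly (W k) c"
    unfolding F_product poly_mult ..
  have "?M * (n + 1) = ?M * n + 2 * k + 1" by simp
  hence "poly (F (?M * n)) c + poly (F (?M * (n + 1))) c = poly (V k) c * poly (W (?M * n + k)) c"
    by (simp only: poly_add[symmetric] poly_mult[symmetric] F_period)
  also have "\<dots> = (-1) ^ n * (poly (V k) c * ((-1) ^ n * poly (W (?M * n + k)) c))"
    by (simp add: mult_ac)
  also have "\<dots> = (-1) ^ n * (poly (F ?M) c * qval k c (?M * n + k))"
    unfolding poly_mid[symmetric] FM by (simp only: mult_ac)
  finally have "poly (F (?M * n)) c / poly (F ?M) c + poly (F (?M * (n + 1))) c / poly (F ?M) c
      = (-1) ^ n * qval k c (?M * n + k)"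
    using nz by (simp add: add_divide_distrib[symmetric])
  thus ?thesis by (simp only: power_mult_distrib) (simp add: power_mult[symmetric])
qed

text \<open>Multiplying \<open>V k * gap k n = (y - 2) * F (M * (n + 1))\<close> at \<open>y = -c\<close> by \<open>V k\<close> at \<open>c\<close> turns the factor on the left
into \<open>F M = V k * W k\<close> and the one on the right into \<open>(c + 2) * V k = L (k + 1) + L k\<close>. Squaring removes the signs.\<close>

lemma gap_squared:
  fixes c :: "'a::field"
  assumes nz: "poly (F (2 * k + 1)) c \<noteq> 0" and k: "1 \<le> k"
  shows "poly (gap k n) (-c) ^ 2
    = (poly (L (k + 1)) c + poly (L k) c) ^ 2
      * (poly (F ((2 * k + 1) * (n + 1))) c / poly (F (2 * k + 1)) c) ^ 2"
proof -
  let ?M = "2 * k + 1" and ?m = "(2 * k + 1) * (n + 1)"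
  have FM: "poly (F ?M) c = poly (V k) c * poly (W k) c"
    unfolding F_product poly_mult ..
  have "V k * gap k n = (yvar - 2) * (F ?m :: 'a poly)"
    using V_consecutive[of "?M * n + 2 * k", where 'a = 'a] unfolding V_mult_gap[OF k]
    by (simp add: add_ac)
  hence "poly (V k) (-c) * poly (gap k n) (-c) = poly (yvar - 2) (-c) * poly (F ?m) (-c)"
    unfolding poly_mult[symmetric] by (rule arg_cong)
  hence "(-1) ^ k * (poly (W k) c * poly (gap k n) (-c)) = (-c - 2) * ((-1) ^ Suc ?m * poly (F ?m) c)"
    unfolding poly_V_minus poly_F_minus by (simp add: mult.assoc)
  hence "((-1) ^ k * (poly (W k) c * poly (gap k n) (-c))) ^ 2 = ((-c - 2) * ((-1) ^ Suc ?m * poly (F ?m) c)) ^ 2"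
    by (rule arg_cong)
  hence "(poly (W k) c * poly (gap k n) (-c)) ^ 2 = ((c + 2) * poly (F ?m) c) ^ 2"
  proof -
    have "((-1 :: 'a) ^ j) ^ 2 = 1" for j by (simp add: power_mult[symmetric])
    moreover have "(-c - 2) ^ 2 = (c + 2) ^ 2" by (simp add: power2_eq_square algebra_simps)
    ultimately show ?thesis
      using \<open>((-1) ^ k * (poly (W k) c * poly (gap k n) (-c))) ^ 2 = _\<close>
      by (simp only: power_mult_distrib mult_1_left)
  qed
  hence "(poly (F ?M) c * poly (gap k n) (-c)) ^ 2 = ((c + 2) * poly (V k) c * poly (F ?m) c) ^ 2"
    unfolding FM by (simp add: power_mult_distrib mult_ac)
  also have "(c + 2) * poly (V k) c = poly ((yvar + 2) * V k) c" by simp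
  also have "\<dots> = poly (L (k + 1)) c + poly (L k) c" unfolding V_mult_L by simp
  finally have sq: "(poly (F ?M) c * poly (gap k n) (-c)) ^ 2
      = ((poly (L (k + 1)) c + poly (L k) c) * poly (F ?m) c) ^ 2" .
  have "g ^ 2 = s ^ 2 * (f / x) ^ 2" if "(x * g) ^ 2 = (s * f) ^ 2" "x \<noteq> 0" for x g s f :: 'a
    using that by (simp add: power_mult_distrib power_divide field_simps)
  from this[OF sq nz] show ?thesis .
qed

lemma poly_pderiv_W_minus:
  fixes c :: "'a::idom"
  shows "poly (pderiv (W k)) (-c) = (-1) ^ Suc k * (poly (pderiv (F (k + 1))) c - poly (pderiv (F k)) c)"
  by (simp add: W_def pderiv_add poly_pderiv_F_minus algebra_simps)

text \<open>Both determinants are Wronskians with \<open>gap k n\<close>, and the unknown parts of the two middle quotients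
cancel because these quotients differ by \<open>W k * gap k n\<close>.\<close>

lemma H_sum_relation:
  fixes c :: "'a::field"
  assumes nz: "poly (F (2 * k + 1)) c \<noteq> 0" and k: "1 \<le> k"
  shows "H c k ((2 * k + 1) * n + 2 * k) + (-1) ^ ((k - 1) choose 2) * H c k ((2 * k + 1) * n + k)
    = (-1) ^ k * (poly (L (k + 1)) c + poly (L k) c) ^ 2 *
      (poly (pderiv (F (k + 1))) c - poly (pderiv (F k)) c) *
      (poly (F ((2 * k + 1) * (n + 1))) c / poly (F (2 * k + 1)) c) ^ 2"
proof -
  let ?M = "2 * k + 1"
  let ?b = "poly (gap k n) (-c)" and ?b' = "poly (pderiv (gap k n)) (-c)"
  let ?a = "qval k c (?M * n + k)" and ?a' = "qder k c (?M * n + k)"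
  have sign: "(-1 :: 'a) ^ ((k - 1) choose 2) * (-1) ^ ((k + 1) choose 2) = -1"
  proof -
    obtain j where j: "k = Suc j" using k by (cases k) auto
    show ?thesis unfolding j minus_one_power_iff
      by (simp add: choose_two_Suc)
  qed
  have "(-1) ^ ((k - 1) choose 2) * H c k (?M * n + k) = - (?a * ?b' - ?a' * ?b)"
    unfolding H_residue_k[OF k] mult.assoc[symmetric] sign by simp
  hence "H c k (?M * n + 2 * k) + (-1) ^ ((k - 1) choose 2) * H c k (?M * n + k)
      = - poly (pderiv (W k)) (-c) * ?b ^ 2"
    unfolding H_residue_2k[OF k] q_mid_diff[OF k]
    by (simp add: algebra_simps power2_eq_square)
  thus ?thesis unfolding gap_squared[OF nz k] poly_pderiv_W_minus by simp
qed

section \<open>The indeterminate\<close>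

lemma poly_F_indet: "poly (F n) indet = Fract (F n) 1"
proof (induction n rule: two_step_induct)
  case (step n)
  have "poly (F (Suc (Suc n))) indet = indet * poly (F (Suc n)) indet - poly (F n) indet"
    by (simp add: F_rec yvar_def)
  thus ?case unfolding step by (simp add: indet_def F_rec yvar_def)
qed (simp_all add: Zero_fract_def One_fract_def)

lemma F_int_nonzero: "F (Suc n) \<noteq> (0 :: int poly)"
proof -
  have "coeff (F (Suc n) :: int poly) n = 1 \<and> (\<forall>i>n. coeff (F (Suc n) :: int poly) i = 0)"
  proof (induction n rule: two_step_induct)
    case (step n)
    have "coeff (F (Suc (Suc (Suc n))) :: int poly) i
        = (case i of 0 \<Rightarrow> 0 | Suc j \<Rightarrow> coeff (F (Suc (Suc n)) :: int poly) j) - coeff (F (Suc n) :: int poly) i" for i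
      by (simp add: F_rec[of "Suc n"] yvar_def coeff_pCons)
    thus ?case using step by (auto split: nat.split)
  qed (auto simp: F_rec yvar_def coeff_pCons split: nat.split)
  thus ?thesis by force
qed

lemma poly_F_indet_nonzero: "0 < n \<Longrightarrow> poly (F n) indet \<noteq> 0"
  using F_int_nonzero[of "n - 1"] by (simp add: poly_F_indet Zero_fract_def eq_fract)

theorem theorem1p8:
  fixes c :: ratfun
  assumes c: "c = indet"
  shows
    "(\<forall>k n r N :: nat. k \<ge> 2 \<and> r \<le> 2 * k \<and> N = (2 * k + 1) * n + r \<longrightarrow>
        (r = 0 \<longrightarrow>
          H c k N =
            (poly (F ((2 * k + 1) * n)) c / poly (F (2 * k + 1)) c
             + poly (F ((2 * k + 1) * (n + 1))) c / poly (F (2 * k + 1)) c) ^ 2) \<and>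
        (r = k - 1 \<longrightarrow>
          H c k N = (-1) ^ ((k - 1) choose 2) *
            (poly (F ((2 * k + 1) * n)) c / poly (F (2 * k + 1)) c
             + poly (F ((2 * k + 1) * (n + 1))) c / poly (F (2 * k + 1)) c) ^ 2) \<and>
        (r = k + 1 \<longrightarrow>
          H c k N = (-1) ^ ((k + 1) choose 2) * (poly (L (k + 1)) c + poly (L k) c) ^ 2 *
            (poly (F ((2 * k + 1) * (n + 1))) c / poly (F (2 * k + 1)) c) ^ 2) \<and>
        (r = 2 * k - 1 \<longrightarrow>
          H c k N = - ((poly (L (k + 1)) c + poly (L k) c) ^ 2) *
            (poly (F ((2 * k + 1) * (n + 1))) c / poly (F (2 * k + 1)) c) ^ 2) \<and>
        (r \<notin> {0, k - 1, k, k + 1, 2 * k - 1, 2 * k} \<longrightarrow> H c k N = 0))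
   \<and> (\<forall>k n :: nat. k \<ge> 2 \<longrightarrow>
        H c k ((2 * k + 1) * n + 2 * k)
          + (-1) ^ ((k - 1) choose 2) * H c k ((2 * k + 1) * n + k)
        = (-1) ^ k * (poly (L (k + 1)) c + poly (L k) c) ^ 2 *
          (poly (pderiv (F (k + 1))) c - poly (pderiv (F k)) c) *
          (poly (F ((2 * k + 1) * (n + 1))) c / poly (F (2 * k + 1)) c) ^ 2)
   \<and> (\<forall>n :: nat.
        H c 1 (3 * n)
        = (poly (F (3 * n)) c / (c ^ 2 - 1) + poly (F (3 * n + 3)) c / (c ^ 2 - 1)) ^ 2)
   \<and> (\<forall>n :: nat.
        H c 1 (3 * n + 2) + H c 1 (3 * n + 1)
        = - (((c + 2) / (c + 1) * poly (F (3 * n + 3)) c) ^ 2))"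
proof -
  have nz: "poly (F (2 * k + 1)) c \<noteq> 0" for k
    unfolding c by (rule poly_F_indet_nonzero) simp
  have r0: "H c k ((2 * k + 1) * n) = (poly (F ((2 * k + 1) * n)) c / poly (F (2 * k + 1)) c
      + poly (F ((2 * k + 1) * (n + 1))) c / poly (F (2 * k + 1)) c) ^ 2" if "1 \<le> k" for k n
    unfolding H_residue_0[OF that] by (rule qval_mid_squared[OF nz])
  have part1: "(r = 0 \<longrightarrow>
          H c k N =
            (poly (F ((2 * k + 1) * n)) c / poly (F (2 * k + 1)) c
             + poly (F ((2 * k + 1) * (n + 1))) c / poly (F (2 * k + 1)) c) ^ 2) \<and>
        (r = k - 1 \<longrightarrow>
          H c k N = (-1) ^ ((k - 1) choose 2) *
            (poly (F ((2 * k + 1) * n)) c / poly (F (2 * k + 1)) c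
             + poly (F ((2 * k + 1) * (n + 1))) c / poly (F (2 * k + 1)) c) ^ 2) \<and>
        (r = k + 1 \<longrightarrow>
          H c k N = (-1) ^ ((k + 1) choose 2) * (poly (L (k + 1)) c + poly (L k) c) ^ 2 *
            (poly (F ((2 * k + 1) * (n + 1))) c / poly (F (2 * k + 1)) c) ^ 2) \<and>
        (r = 2 * k - 1 \<longrightarrow>
          H c k N = - ((poly (L (k + 1)) c + poly (L k) c) ^ 2) *
            (poly (F ((2 * k + 1) * (n + 1))) c / poly (F (2 * k + 1)) c) ^ 2) \<and>
        (r \<notin> {0, k - 1, k, k + 1, 2 * k - 1, 2 * k} \<longrightarrow> H c k N = 0)"
    if "k \<ge> 2 \<and> r \<le> 2 * k \<and> N = (2 * k + 1) * n + r" for k n r N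
  proof -
    have k: "2 \<le> k" "1 \<le> k" and r: "r \<le> 2 * k" and N: "N = (2 * k + 1) * n + r"
      using that by auto
    note sq = qval_mid_squared[OF nz, symmetric] gap_squared[OF nz k(2), symmetric]
    show ?thesis
    proof (intro conjI impI)
      assume "r = 0" thus "H c k N =
            (poly (F ((2 * k + 1) * n)) c / poly (F (2 * k + 1)) c
             + poly (F ((2 * k + 1) * (n + 1))) c / poly (F (2 * k + 1)) c) ^ 2"
        unfolding N using r0[OF k(2)] by (simp only: add_0_right)
    next
      assume r: "r = k - 1"
      show "H c k N = (-1) ^ ((k - 1) choose 2) *
            (poly (F ((2 * k + 1) * n)) c / poly (F (2 * k + 1)) c
             + poly (F ((2 * k + 1) * (n + 1))) c / poly (F (2 * k + 1)) c) ^ 2"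
        unfolding N r sq by (rule H_residue_k_minus_1[OF k(2)])
    next
      assume r: "r = k + 1"
      show "H c k N = (-1) ^ ((k + 1) choose 2) * (poly (L (k + 1)) c + poly (L k) c) ^ 2 *
            (poly (F ((2 * k + 1) * (n + 1))) c / poly (F (2 * k + 1)) c) ^ 2"
        unfolding N r mult.assoc[of "(-1) ^ ((k + 1) choose 2)"] sq by (rule H_residue_k_plus_1[OF k(1)])
    next
      assume r: "r = 2 * k - 1"
      show "H c k N = - ((poly (L (k + 1)) c + poly (L k) c) ^ 2) *
            (poly (F ((2 * k + 1) * (n + 1))) c / poly (F (2 * k + 1)) c) ^ 2"
        unfolding N r mult_minus_left sq by (rule H_residue_2k_minus_1[OF k(1)])
    next
      assume "r \<notin> {0, k - 1, k, k + 1, 2 * k - 1, 2 * k}"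
      thus "H c k N = 0" unfolding N using r by (rule H_residue_other[rotated])
    qed
  qed
  \<comment> \<open>For \<open>k = 1\<close> the general formulas specialise by \<open>F 3 = y^2 - 1\<close> and \<open>L 2 + L 1 = (y + 2) * (y - 1)\<close>.\<close>
  have F3: "poly (F (2 * 1 + 1)) c = c ^ 2 - 1"
    by (simp add: numeral_3_eq_3 F_rec yvar_def power2_eq_square)
  have e: "(2 * 1 + 1) * n = 3 * n" "(2 * 1 + 1) * (n + 1) = 3 * n + 3" for n :: nat by simp_all
  have part3: "H c 1 (3 * n) = (poly (F (3 * n)) c / (c ^ 2 - 1) + poly (F (3 * n + 3)) c / (c ^ 2 - 1)) ^ 2"
    for n using r0[OF order_refl, of n] unfolding F3 unfolding e(2) unfolding e(1) .
  have part4: "H c 1 (3 * n + 2) + H c 1 (3 * n + 1) = - (((c + 2) / (c + 1) * poly (F (3 * n + 3)) c) ^ 2)"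
    for n
  proof -
    have L: "poly (L (1 + 1)) c + poly (L 1) c = (c + 2) * (c - 1)"
      by (simp add: L_rec L_1 algebra_simps power2_eq_square)
    have D: "poly (pderiv (F (1 + 1))) c - poly (pderiv (F 1)) c = 1"
      by (simp add: F_rec)
    have "c ^ 2 - 1 \<noteq> 0" using nz[of 1] unfolding F3 .
    moreover have sq: "c ^ 2 - 1 = (c + 1) * (c - 1)" by (simp add: power2_eq_square algebra_simps)
    ultimately have n0: "c + 1 \<noteq> 0" "c - 1 \<noteq> 0" by auto
    have "H c 1 (3 * n + 2) + H c 1 (3 * n + 1)
        = - (((c + 2) * (c - 1)) ^ 2 * (poly (F (3 * n + 3)) c / ((c + 1) * (c - 1))) ^ 2)"
      using H_sum_relation[OF nz[of 1], of n] unfolding F3 unfolding e(2) unfolding e(1) L D sq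
      by (simp add: numeral_2_eq_2)
    also have "\<dots> = - (((c + 2) * (c - 1) * (poly (F (3 * n + 3)) c / ((c + 1) * (c - 1)))) ^ 2)"
      by (simp only: power_mult_distrib)
    also have "(c + 2) * (c - 1) * (poly (F (3 * n + 3)) c / ((c + 1) * (c - 1)))
        = (c + 2) / (c + 1) * poly (F (3 * n + 3)) c"
      using n0 by simp
    finally show ?thesis .
  qed
  show ?thesis
  proof (rule conjI[OF _ conjI[OF _ conjI]], goal_cases)
    case 1 show ?case by (intro allI impI) (rule part1)
  next
    case 2 show ?case by (intro allI impI H_sum_relation[OF nz]) simp
  next
    case 3 show ?case by (intro allI part3)
  next
    case 4 show ?case by (intro allI part4)
  qed
qed

end
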